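(* For the CLTSP restricted to instances with zero processing times ($\tau(a)=0$ for all $a$), arbitrary time windows $[r(a),d(a)]$ and fast clients ($v\ge1$), there exists an algorithm that in $O(n\log n)$ time either correctly reports that the instance is infeasible or computes an optimal solution.
   Context: An instance of the line traveling salesman problem with collaboration (CLTSP) consists of a finite set $A$ of clients, $n=|A|$, a client speed $v>0$, and for each client $a\in A$ a starting position $s(a)\in\mathbb{R}$, a release date $r(a)\in\mathbb{R}_{\ge 0}$, a deadline $d(a)\in\mathbb{R}_{\ge0}\cup\{\infty\}$ and a processing time $\tau(a)\in\mathbb{R}_{\ge0}$. A single server starts at time $0$ at position $0$ and moves along the real line with speed at most $1$ (it may wait). Client $a$ is at position $s(a)$ at time $r(a)$ and from then on can move along the line with speed at most $v$ (or wait). A solution is a pair $(t,x)$ of maps $t:A\to\mathbb{R}_{\ge0}$, $x:A\to\mathbb{R}$, where $(t(a),x(a))$ is the time and position of the rendezvous of the server with client $a$. Let $\sigma_1,\dots,\sigma_n$ be the clients ordered by rendezvous time, put $(t_i,x_i)=(t(\sigma_i),x(\sigma_i))$ for $1\le i\le n$, $(t_0,x_0)=(0,0)$, and let $(t_{n+1},x_{n+1})$ be the time and position at which the server ends. Completion times are $c_0=0$, $c_i=t_i+\tau(\sigma_i)$ for $1\le i\le n$, $c_{n+1}=t_{n+1}$. The solution is feasible if $x_{n+1}=0$; $t_i\ge c_{i-1}+|x_i-x_{i-1}|$ for all $1\le i\le n+1$; $t(a)\ge r(a)+|x(a)-s(a)|/v$ for all $a\in A$; and $r(a)\le t(a)\le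 d(a)$ for all $a$. The makespan is $C_{\max}(t,x)=c_{n+1}$; the CLTSP asks for a feasible solution of minimum makespan (an optimal solution); an instance is infeasible if it has no feasible solution. *)

theory Defs
  imports Complex_Main "HOL-Library.Extended_Real" "HOL-Library.Landau_Symbols"
begin

section \<open>The line travelling salesman problem with collaboration\<close>

record 'a cltsp =
  clients :: "'a set"
  speed :: real
  start :: "'a \<Rightarrow> real"
  release :: "'a \<Rightarrow> real"
  deadline :: "'a \<Rightarrow> ereal"
  proc :: "'a \<Rightarrow> real"

definition cltsp_instance :: "'a cltsp \<Rightarrow> bool" where
  "cltsp_instance I \<longleftrightarrow> finite (clients I) \<and> speed I > 0 \<and>
     (\<forall>a\<in>clients I. release I a \<ge> 0 \<and> deadline I a \<ge> 0 \<and> proc I a \<ge> 0)"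

text \<open>
  Besides the maps \<open>t\<close> and \<open>x\<close>, a solution records the time and position at which the server ends,
  since these are not determined by \<open>t\<close> and \<open>x\<close> alone (the server may wait). Values of the maps
  outside the client set are irrelevant.
\<close>

record 'a solution =
  rdv_time :: "'a \<Rightarrow> real"
  rdv_pos :: "'a \<Rightarrow> real"
  end_time :: real
  end_pos :: real

text \<open>
  The list \<open>os\<close> is an order \<open>\<sigma>\<^sub>1, \<dots>, \<sigma>\<^sub>n\<close> of the clients; lists count from 0, so \<open>\<sigma>\<^sub>i\<close> is \<open>os ! (i - 1)\<close>.
  The three functions below are \<open>t\<^sub>i\<close>, \<open>x\<^sub>i\<close> and \<open>c\<^sub>i\<close> for \<open>0 \<le> i \<le> n + 1\<close>.
\<close>

definition ev_time :: "'a solution \<Rightarrow> 'a list \<Rightarrow> nat \<Rightarrow> real" where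
  "ev_time S os i = (if i = 0 then 0
     else if i \<le> length os then rdv_time S (os ! (i - 1)) else end_time S)"

definition ev_pos :: "'a solution \<Rightarrow> 'a list \<Rightarrow> nat \<Rightarrow> real" where
  "ev_pos S os i = (if i = 0 then 0
     else if i \<le> length os then rdv_pos S (os ! (i - 1)) else end_pos S)"

definition completion :: "'a cltsp \<Rightarrow> 'a solution \<Rightarrow> 'a list \<Rightarrow> nat \<Rightarrow> real" where
  "completion I S os i = (if i = 0 then 0
     else if i \<le> length os then ev_time S os i + proc I (os ! (i - 1)) else ev_time S os i)"

definition rdv_order :: "'a cltsp \<Rightarrow> 'a solution \<Rightarrow> 'a list \<Rightarrow> bool" where
  "rdv_order I S os \<longleftrightarrow> distinct os \<and> set os = clients I \<and> sorted (map (rdv_time S) os)"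

text \<open>
  Rendezvous at equal times may be ordered in several ways; a solution is feasible if some order
  by rendezvous time works.
\<close>

definition feasible :: "'a cltsp \<Rightarrow> 'a solution \<Rightarrow> bool" where
  "feasible I S \<longleftrightarrow>
     end_pos S = 0 \<and>
     (\<exists>os. rdv_order I S os \<and>
        (\<forall>i\<in>{1..length os + 1}. ev_time S os i \<ge>
           completion I S os (i - 1) + \<bar>ev_pos S os i - ev_pos S os (i - 1)\<bar>)) \<and>
     (\<forall>a\<in>clients I. rdv_time S a \<ge> 0 \<and>
        rdv_time S a \<ge> release I a + \<bar>rdv_pos S a - start I a\<bar> / speed I \<and>
        release I a \<le> rdv_time S a \<and> ereal (rdv_time S a) \<le> deadline I a)"

definition makespan :: "'a solution \<Rightarrow> real" where
  "makespan S = end_time S"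

definition optimal :: "'a cltsp \<Rightarrow> 'a solution \<Rightarrow> bool" where
  "optimal I S \<longleftrightarrow> feasible I S \<and> (\<forall>S'. feasible I S' \<longrightarrow> makespan S \<le> makespan S')"

definition infeasible :: "'a cltsp \<Rightarrow> bool" where
  "infeasible I \<longleftrightarrow> \<not> (\<exists>S. feasible I S)"


section \<open>Real RAM programs and their running time\<close>

text \<open>
  The running time of an algorithm is the unit-cost running time on a real RAM, whose programs are
  written as structured while programs. A state consists of variables and arrays over the natural
  numbers and over the reals; array indices are natural numbers. Constants are integers, and the
  only interaction between the two sorts is that real arrays are indexed by naturals and that
  comparisons of reals control the program flow; in particular there is no rounding. Every node of an
  expression and every elementary command costs one time unit.
\<close>

type_synonym vname = string

record state =
  nvar :: "vname \<Rightarrow> nat"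
  narr :: "vname \<Rightarrow> nat \<Rightarrow> nat"
  rvar :: "vname \<Rightarrow> real"
  rarr :: "vname \<Rightarrow> nat \<Rightarrow> real"

datatype nexp = NConst nat | NVar vname | NArr vname nexp | NAdd nexp nexp | NSub nexp nexp

datatype rexp = RConst int | RVar vname | RArr vname nexp
  | RAdd rexp rexp | RSub rexp rexp | RMul rexp rexp | RDiv rexp rexp

datatype bexp = NLess nexp nexp | RLess rexp rexp | Neg bexp | Conj bexp bexp

datatype com = Skip
  | NAssign vname nexp | NStore vname nexp nexp
  | RAssign vname rexp | RStore vname nexp rexp
  | Seq com com | Cond bexp com com | While bexp com

text \<open>Subtraction of naturals is truncated at 0, and division by 0 yields 0.\<close>

fun nval :: "nexp \<Rightarrow> state \<Rightarrow> nat" where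
  "nval (NConst k) s = k"
| "nval (NVar y) s = nvar s y"
| "nval (NArr y e) s = narr s y (nval e s)"
| "nval (NAdd e f) s = nval e s + nval f s"
| "nval (NSub e f) s = nval e s - nval f s"

fun rval :: "rexp \<Rightarrow> state \<Rightarrow> real" where
  "rval (RConst k) s = real_of_int k"
| "rval (RVar y) s = rvar s y"
| "rval (RArr y e) s = rarr s y (nval e s)"
| "rval (RAdd e f) s = rval e s + rval f s"
| "rval (RSub e f) s = rval e s - rval f s"
| "rval (RMul e f) s = rval e s * rval f s"
| "rval (RDiv e f) s = rval e s / rval f s"

fun bval :: "bexp \<Rightarrow> state \<Rightarrow> bool" where
  "bval (NLess e f) s \<longleftrightarrow> nval e s < nval f s"
| "bval (RLess e f) s \<longleftrightarrow> rval e s < rval f s"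
| "bval (Neg b) s \<longleftrightarrow> \<not> bval b s"
| "bval (Conj b c) s \<longleftrightarrow> bval b s \<and> bval c s"

fun ncost :: "nexp \<Rightarrow> nat" where
  "ncost (NConst k) = 1"
| "ncost (NVar y) = 1"
| "ncost (NArr y e) = 1 + ncost e"
| "ncost (NAdd e f) = 1 + ncost e + ncost f"
| "ncost (NSub e f) = 1 + ncost e + ncost f"

fun rcost :: "rexp \<Rightarrow> nat" where
  "rcost (RConst k) = 1"
| "rcost (RVar y) = 1"
| "rcost (RArr y e) = 1 + ncost e"
| "rcost (RAdd e f) = 1 + rcost e + rcost f"
| "rcost (RSub e f) = 1 + rcost e + rcost f"
| "rcost (RMul e f) = 1 + rcost e + rcost f"
| "rcost (RDiv e f) = 1 + rcost e + rcost f"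

fun bcost :: "bexp \<Rightarrow> nat" where
  "bcost (NLess e f) = 1 + ncost e + ncost f"
| "bcost (RLess e f) = 1 + rcost e + rcost f"
| "bcost (Neg b) = 1 + bcost b"
| "bcost (Conj b c) = 1 + bcost b + bcost c"

text \<open>
  \<open>exec c s k s'\<close>: started in state \<open>s\<close>, the program \<open>c\<close> terminates in state \<open>s'\<close> after \<open>k\<close> time units.
\<close>

inductive exec :: "com \<Rightarrow> state \<Rightarrow> nat \<Rightarrow> state \<Rightarrow> bool" where
  Skip: "exec Skip s 1 s"
| NAssign: "exec (NAssign y e) s (1 + ncost e) (s\<lparr>nvar := (nvar s)(y := nval e s)\<rparr>)"
| NStore: "exec (NStore y i e) s (1 + ncost i + ncost e)
    (s\<lparr>narr := (narr s)(y := (narr s y)(nval i s := nval e s))\<rparr>)"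
| RAssign: "exec (RAssign y e) s (1 + rcost e) (s\<lparr>rvar := (rvar s)(y := rval e s)\<rparr>)"
| RStore: "exec (RStore y i e) s (1 + ncost i + rcost e)
    (s\<lparr>rarr := (rarr s)(y := (rarr s y)(nval i s := rval e s))\<rparr>)"
| Seq: "exec c s k s' \<Longrightarrow> exec c' s' k' s'' \<Longrightarrow> exec (Seq c c') s (k + k') s''"
| CondTrue: "bval b s \<Longrightarrow> exec c s k s' \<Longrightarrow> exec (Cond b c c') s (1 + bcost b + k) s'"
| CondFalse: "\<not> bval b s \<Longrightarrow> exec c' s k s' \<Longrightarrow> exec (Cond b c c') s (1 + bcost b + k) s'"
| WhileFalse: "\<not> bval b s \<Longrightarrow> exec (While b c) s (1 + bcost b) s"
| WhileTrue: "bval b s \<Longrightarrow> exec c s k s' \<Longrightarrow> exec (While b c) s' k' s'' \<Longrightarrow>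
    exec (While b c) s (1 + bcost b + k + k') s''"

lemma exec_deterministic:
  "exec c s k s' \<Longrightarrow> exec c s l u \<Longrightarrow> k = l \<and> s' = u"
proof (induction arbitrary: l u rule: exec.induct)
  case (Skip s)
  then show ?case by cases (intro conjI; erule sym)
next
  case (NAssign y e s)
  then show ?case by cases (intro conjI; erule sym)
next
  case (NStore y i e s)
  then show ?case by cases (intro conjI; erule sym)
next
  case (RAssign y e s)
  then show ?case by cases (intro conjI; erule sym)
next
  case (RStore y i e s)
  then show ?case by cases (intro conjI; erule sym)
next
  case (Seq c s k s' c' k' s'')
  from Seq.prems obtain l1 u1 l2 where "l = l1 + l2" "exec c s l1 u1" "exec c' u1 l2 u"
    by cases blast
  with Seq.IH show ?case by blast
next
  case (CondTrue b s c k s' c')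
  from CondTrue.prems CondTrue.hyps obtain l1 where "l = 1 + bcost b + l1" "exec c s l1 u"
    by cases blast+
  with CondTrue.IH show ?case by blast
next
  case (CondFalse b s c' k s' c)
  from CondFalse.prems CondFalse.hyps obtain l1 where "l = 1 + bcost b + l1" "exec c' s l1 u"
    by cases blast+
  with CondFalse.IH show ?case by blast
next
  case (WhileFalse b s c)
  from WhileFalse.prems WhileFalse.hyps show ?case by cases blast+
next
  case (WhileTrue b s c k s' k' s'')
  from WhileTrue.prems WhileTrue.hyps obtain l1 u1 l2
    where "l = 1 + bcost b + l1 + l2" "exec c s l1 u1" "exec (While b c) u1 l2 u"
    by cases blast+
  with WhileTrue.IH show ?case by blast
qed


section \<open>Algorithms for the CLTSP\<close>

text \<open>
  An instance is presented to a program through an enumeration \<open>as\<close> of its clients. The array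
  \<open>''inf''\<close> marks the infinite deadlines, for which the array \<open>''d''\<close> holds 0
  (this is the value of \<^const>\<open>real_of_ereal\<close> at infinity). Everything else is initially 0.
\<close>

definition client_array :: "'a list \<Rightarrow> ('a \<Rightarrow> 'b::zero) \<Rightarrow> nat \<Rightarrow> 'b" where
  "client_array as f = (\<lambda>i. if i < length as then f (as ! i) else 0)"

definition input_state :: "'a cltsp \<Rightarrow> 'a list \<Rightarrow> state" where
  "input_state I as =
    \<lparr> nvar = (\<lambda>_. 0)(''n'' := length as),
      narr = (\<lambda>_ _. 0)(''inf'' := client_array as (\<lambda>a. if deadline I a = \<infinity> then 1 else 0)),
      rvar = (\<lambda>_. 0)(''v'' := speed I),
      rarr = (\<lambda>_ _. 0)
        (''s'' := client_array as (start I),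
         ''r'' := client_array as (release I),
         ''d'' := client_array as (\<lambda>a. real_of_ereal (deadline I a)),
         ''tau'' := client_array as (proc I)) \<rparr>"

text \<open>
  A program reports infeasibility by leaving the value 0 in \<open>''feasible''\<close>. Otherwise it leaves 1
  there, the rendezvous times and positions in the arrays \<open>''t''\<close> and \<open>''x''\<close>, and the time at which
  the server ends in \<open>''end''\<close>.
\<close>

definition correct_output :: "'a cltsp \<Rightarrow> 'a list \<Rightarrow> state \<Rightarrow> bool" where
  "correct_output I as s \<longleftrightarrow>
     nvar s ''feasible'' = 0 \<and> infeasible I \<or>
     nvar s ''feasible'' = 1 \<and>
       (\<exists>S. optimal I S \<and> end_time S = rvar s ''end'' \<and>
          (\<forall>i<length as. rdv_time S (as ! i) = rarr s ''t'' i \<and> rdv_pos S (as ! i) = rarr s ''x'' i))"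

text \<open>
  The program solves all instances of the class \<open>K\<close>, and on instances with \<open>n\<close> clients it takes at most
  \<open>T n\<close> time units.
\<close>

definition solves_in_time :: "com \<Rightarrow> ('a cltsp \<Rightarrow> bool) \<Rightarrow> (nat \<Rightarrow> real) \<Rightarrow> bool" where
  "solves_in_time P K T \<longleftrightarrow>
     (\<forall>I as. cltsp_instance I \<and> K I \<and> distinct as \<and> set as = clients I \<longrightarrow>
        (\<exists>k s. exec P (input_state I as) k s \<and> real k \<le> T (card (clients I)) \<and>
           correct_output I as s))"

end

theory Submission
  imports Defs "HOL-Library.Multiset" "HOL-Real_Asymp.Real_Asymp"
begin

text \<open>
  A client that is at least as fast as the server can follow the server once they have met. So a path
  \<open>y\<close> of the server that ends at time \<open>T\<close> serves client \<open>a\<close> if and only if, at time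
  \<open>u = min (d a) T\<close>, it lies in the cone \<open>\<bar>y u - s a\<bar> \<le> v * (u - r a)\<close>, and then \<open>a\<close> may as well be met at
  time \<open>u\<close>. What remains is to find a 1-Lipschitz path from 0 to 0 that passes through an interval at
  every deadline before \<open>T\<close>, where \<open>T\<close> is at least \<open>R\<close>, the maximum of \<open>r a + \<bar>s a\<bar> / v\<close>.

  Scanning the finite deadlines in increasing order, one maintains the interval of positions that the
  server can have. The instance is infeasible if and only if one of these intervals is empty.
  Otherwise the optimum is the maximum of \<open>R\<close> and of \<open>d a\<close> plus the distance from 0 to the interval
  at \<open>d a\<close>, taken over the deadlines \<open>d a < R\<close>, and scanning backwards from position 0 while always
  moving to the nearest point of the next interval yields an optimal path. Sorting the deadlines
  dominates the running time.
\<close>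

section \<open>Feasible solutions and server paths\<close>

text \<open>A solution fixes the server only at its events. A path through them exists because the
  events form a 1-Lipschitz partial map; indexing by numbers allows several events at one time,
  which then share their position.\<close>

lemma lipschitz_extension:
  fixes t x :: "nat \<Rightarrow> real"
  assumes lip: "\<And>i j. i \<le> N \<Longrightarrow> j \<le> N \<Longrightarrow> \<bar>x i - x j\<bar> \<le> \<bar>t i - t j\<bar>"
  obtains y where "\<And>u w. \<bar>y u - y w\<bar> \<le> \<bar>u - w\<bar>" "\<And>i. i \<le> N \<Longrightarrow> y (t i) = x i"
proof
  \<comment> \<open>McShane's extension\<close>
  define F where "F u = (\<lambda>i. x i + \<bar>u - t i\<bar>) ` {..N}" for u
  define y where "y u = Min (F u)" for u
  have fin: "finite (F u)" "F u \<noteq> {}" for u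
    by (auto simp: F_def)
  \<comment> \<open>A minimum of finitely many 1-Lipschitz functions is 1-Lipschitz.\<close>
  have le: "y u \<le> y w + \<bar>u - w\<bar>" for u w
  proof -
    have "y w \<in> F w"
      unfolding y_def using fin by (rule Min_in)
    then obtain i where i: "i \<le> N" "y w = x i + \<bar>w - t i\<bar>"
      by (auto simp: F_def)
    have "y u \<le> x i + \<bar>u - t i\<bar>"
      unfolding y_def using i by (intro Min_le fin) (auto simp: F_def)
    then show ?thesis
      using i by linarith
  qed
  show "\<bar>y u - y w\<bar> \<le> \<bar>u - w\<bar>" for u w
    using le[of u w] le[of w u] by linarith
  show "y (t i) = x i" if "i \<le> N" for i
    unfolding y_def
  proof (rule Min_eqI)
    show "x i \<in> F (t i)"
      using that by (auto simp: F_def intro!: image_eqI[of _ _ i])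
    show "x i \<le> z" if "z \<in> F (t i)" for z
      using that lip[OF \<open>i \<le> N\<close>] by (fastforce simp: F_def abs_le_iff)
  qed (rule fin)
qed

text \<open>With zero processing times a completion time is the rendezvous time, so consecutive
  events obey the Lipschitz bound. Telescoping extends it to all pairs of events, and
  \<open>lipschitz_extension\<close> joins them.\<close>

lemma feasible_path:
  assumes feas: "feasible I S" and proc: "\<forall>a\<in>clients I. proc I a = 0"
  obtains y where "\<And>u w. \<bar>y u - y w\<bar> \<le> \<bar>u - w\<bar>" "y 0 = 0"
    "\<And>u. end_time S \<le> u \<Longrightarrow> y u = 0" "0 \<le> end_time S"
    "\<And>a. a \<in> clients I \<Longrightarrow> rdv_time S a \<le> end_time S \<and> y (rdv_time S a) = rdv_pos S a"
proof -
  from feas obtain os where os: "rdv_order I S os" and endp: "end_pos S = 0"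
    and step: "\<And>i. i \<in> {1..length os + 1} \<Longrightarrow>
      completion I S os (i - 1) + \<bar>ev_pos S os i - ev_pos S os (i - 1)\<bar> \<le> ev_time S os i"
    unfolding feasible_def by blast
  define N where "N = length os + 1"
  let ?t = "ev_time S os" and ?x = "ev_pos S os"
  have set_os: "set os = clients I"
    using os by (simp add: rdv_order_def)
  have comp: "completion I S os i = ?t i" if "i < N" for i
  proof (cases i)
    case (Suc k)
    then have "os ! k \<in> clients I"
      using that nth_mem[of k os] by (simp add: set_os N_def)
    then show ?thesis
      using that proc Suc by (simp add: completion_def N_def)
  qed (simp add: completion_def ev_time_def)
  have step': "\<bar>?x (Suc i) - ?x i\<bar> \<le> ?t (Suc i) - ?t i" if "i < N" for i
    using step[of "Suc i"] comp[OF that] that by (simp add: N_def)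
  have chain: "j \<le> N \<Longrightarrow> \<bar>?x j - ?x i\<bar> \<le> ?t j - ?t i" if "i \<le> j" for i j
    using that
  proof (induction j rule: dec_induct)
    case (step j)
    then show ?case
      using step'[of j] by linarith
  qed simp
  have lip: "\<bar>?x i - ?x j\<bar> \<le> \<bar>?t i - ?t j\<bar>" if "i \<le> N" "j \<le> N" for i j
    using chain[of i j] chain[of j i] that nat_le_linear[of i j] by linarith
  obtain z where z: "\<And>u w. \<bar>z u - z w\<bar> \<le> \<bar>u - w\<bar>" "\<And>i. i \<le> N \<Longrightarrow> z (?t i) = ?x i"
    using lipschitz_extension[of N ?x ?t] lip by blast
  have t0: "?t 0 = 0" "?x 0 = 0" and tN: "?t N = end_time S" "?x N = 0"
    by (auto simp: ev_time_def ev_pos_def N_def endp)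
  have T: "?t i \<le> end_time S" if "i \<le> N" for i
    using chain[OF that] tN by linarith
  show ?thesis
  \<comment> \<open>The extension is controlled only at events, so it is stopped at
    \<open>end_time S\<close>; the server then rests at 0, also at deadlines after the tour.\<close>
  proof (rule that[of "\<lambda>u. z (min u (end_time S))"])
    show "\<bar>z (min u (end_time S)) - z (min w (end_time S))\<bar> \<le> \<bar>u - w\<bar>" for u w
      using z(1)[of "min u (end_time S)" "min w (end_time S)"] by linarith
    show pos: "0 \<le> end_time S"
      using T[of 0] t0 by simp
    show "z (min 0 (end_time S)) = 0"
      using z(2)[of 0] t0 pos by (simp add: min_absorb1)
    show "z (min u (end_time S)) = 0" if "end_time S \<le> u" for u
      using z(2)[of N] tN that by (simp add: min_absorb2)
    fix a assume "a \<in> clients I"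
    then obtain k where k: "k < length os" "os ! k = a"
      using set_os by (metis in_set_conv_nth)
    then have "?t (Suc k) = rdv_time S a" "?x (Suc k) = rdv_pos S a"
      by (auto simp: ev_time_def ev_pos_def)
    then show "rdv_time S a \<le> end_time S \<and> z (min (rdv_time S a) (end_time S)) = rdv_pos S a"
      using T[of "Suc k"] z(2)[of "Suc k"] k by (auto simp: N_def min_absorb1)
  qed
qed

text \<open>The pairwise bound does not depend on the order of the clients, so any sorting by
  rendezvous time witnesses feasibility: clients met at the same time are met at the same
  place.\<close>

lemma feasibleI:
  assumes fin: "finite (clients I)" and proc: "\<forall>a\<in>clients I. proc I a = 0"
    and endp: "end_pos S = 0" and endt: "0 \<le> end_time S"
    and lip: "\<And>a b. a \<in> clients I \<Longrightarrow> b \<in> clients I \<Longrightarrow>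
      \<bar>rdv_pos S a - rdv_pos S b\<bar> \<le> \<bar>rdv_time S a - rdv_time S b\<bar>"
    and first: "\<And>a. a \<in> clients I \<Longrightarrow> \<bar>rdv_pos S a\<bar> \<le> rdv_time S a"
    and last: "\<And>a. a \<in> clients I \<Longrightarrow> \<bar>rdv_pos S a\<bar> \<le> end_time S - rdv_time S a"
    and windows: "\<And>a. a \<in> clients I \<Longrightarrow>
      0 \<le> rdv_time S a \<and> release I a + \<bar>rdv_pos S a - start I a\<bar> / speed I \<le> rdv_time S a \<and>
      release I a \<le> rdv_time S a \<and> ereal (rdv_time S a) \<le> deadline I a"
  shows "feasible I S"
proof -
  obtain os where os: "rdv_order I S os"
  proof -
    obtain bs where "set bs = clients I" "distinct bs"
      using finite_distinct_list[OF fin] by blast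
    then have "rdv_order I S (sort_key (rdv_time S) bs)"
      by (simp add: rdv_order_def)
    then show thesis
      by (rule that)
  qed
  then have set_os: "set os = clients I" and sorted: "sorted (map (rdv_time S) os)"
    by (auto simp: rdv_order_def)
  have mem: "k < length os \<Longrightarrow> os ! k \<in> clients I" for k
    using set_os nth_mem by blast
  have "completion I S os i + \<bar>ev_pos S os (Suc i) - ev_pos S os i\<bar> \<le> ev_time S os (Suc i)"
    if "i \<le> length os" for i
  proof (cases i)
    case 0
    then show ?thesis
      using first[OF mem[of 0]] endp endt
      by (cases "os = []") (auto simp: completion_def ev_time_def ev_pos_def Suc_le_eq)
  next
    case (Suc k)
    have pr: "proc I (os ! k) = 0"
      using mem proc Suc that by simp
    show ?thesis
    proof (cases "i = length os")
      case True
      then have "length os - Suc 0 = k"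
        using Suc by simp
      then show ?thesis
        using True last[OF mem[of k]] Suc pr endp
        by (auto simp: completion_def ev_time_def ev_pos_def)
    next
      case False
      then have i: "i < length os"
        using that by simp
      have "rdv_time S (os ! k) \<le> rdv_time S (os ! i)"
        using sorted_nth_mono[OF sorted, of k i] Suc i by simp
      then show ?thesis
        using lip[OF mem[of k] mem[of i]] Suc pr i
        by (auto simp: completion_def ev_time_def ev_pos_def)
    qed
  qed
  then have "\<forall>i\<in>{1..length os + 1}. ev_time S os i \<ge>
      completion I S os (i - 1) + \<bar>ev_pos S os i - ev_pos S os (i - 1)\<bar>"
    by (auto simp: Suc_le_eq gr0_conv_Suc)
  then show ?thesis
    using os endp windows unfolding feasible_def by blast
qed

text \<open>A client that is not slower than the server can stay with it after having met it.\<close>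
lemma cone_path:
  fixes v :: real
  assumes v: "1 \<le> v" and cone: "r + \<bar>x - s\<bar> / v \<le> t" and tu: "t \<le> u"
    and move: "\<bar>y - x\<bar> \<le> u - t"
  shows "\<bar>y - s\<bar> \<le> v * (u - r)"
proof -
  have "\<bar>x - s\<bar> \<le> v * (t - r)"
    using cone v by (simp add: field_simps)
  moreover have "u - t \<le> v * (u - t)"
    using v tu mult_right_mono[of 1 v "u - t"] by simp
  ultimately show ?thesis
    using move by (simp add: algebra_simps)
qed


section \<open>Paths through windows\<close>

text \<open>
  The indices \<open>i < n\<close> enumerate the clients by increasing deadline, and \<open>[wl i, wh i]\<close> is the slice of
  the cone of client \<open>i\<close> at time \<open>d i\<close>; clients with infinite deadline are not \<open>bounded\<close> and carry a
  dummy value in \<open>d\<close>. \<open>[lo i, hi i]\<close> is where the server can be at time \<open>prev i\<close> after passing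
  through the windows with index less than \<open>i\<close>, so the window of client \<open>i\<close> enters at \<open>Suc i\<close>.
  In contrast, \<open>pos k\<close> is the position of the server after \<open>k\<close> steps backwards in time from the end.
\<close>
locale deadline_windows =
  fixes n :: nat and bounded :: "nat \<Rightarrow> bool" and d wl wh :: "nat \<Rightarrow> real" and R :: real
  assumes sorted: "i \<le> j \<Longrightarrow> j < n \<Longrightarrow> d i \<le> d j"
    and nonneg: "i < n \<Longrightarrow> 0 \<le> d i"
begin

text \<open>Clients without a deadline stay in the enumeration and each recursion steps over them,
  so the indices remain those of the sorted array.\<close>

primrec prev :: "nat \<Rightarrow> real" where
  "prev 0 = 0"
| "prev (Suc i) = (if bounded i then d i else prev i)"

primrec lo :: "nat \<Rightarrow> real" where
  "lo 0 = 0"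
| "lo (Suc i) = (if bounded i then max (lo i - (d i - prev i)) (wl i) else lo i)"

primrec hi :: "nat \<Rightarrow> real" where
  "hi 0 = 0"
| "hi (Suc i) = (if bounded i then min (hi i + (d i - prev i)) (wh i) else hi i)"

text \<open>The distance from 0 to a nonempty \<open>[lo, hi]\<close> is the maximum of
  \<open>lo\<close>, \<open>- hi\<close> and 0. The term for 0 would be \<open>d i < R\<close>,
  which the start value \<open>R\<close> covers.\<close>

primrec finish :: "nat \<Rightarrow> real" where
  "finish 0 = R"
| "finish (Suc i) =
    (if bounded i \<and> d i < R then max (max (finish i) (d i + lo (Suc i))) (d i - hi (Suc i))
     else finish i)"

text \<open>The comparison is with \<open>finish n\<close> and not with \<open>R\<close>: a deadline
  before \<open>R\<close> may push the end beyond \<open>R\<close>, and deadlines in between must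
  then still be respected.\<close>

definition early :: "nat \<Rightarrow> bool" where
  "early i \<longleftrightarrow> bounded i \<and> d i < finish n"

text \<open>Step \<open>Suc k\<close> handles index \<open>n - Suc k\<close>, whose interval has the
  successor \<open>n - k\<close> as its index. Clamping moves to the nearest point of that
  interval.\<close>

primrec pos :: "nat \<Rightarrow> real" where
  "pos 0 = 0"
| "pos (Suc k) =
    (if early (n - Suc k) then max (min (pos k) (hi (n - k))) (lo (n - k)) else pos k)"

primrec time :: "nat \<Rightarrow> real" where
  "time 0 = finish n"
| "time (Suc k) = (if early (n - Suc k) then d (n - Suc k) else time k)"

definition meet_time :: "nat \<Rightarrow> real" where
  "meet_time i = (if early i then d i else finish n)"

text \<open>After \<open>n - i\<close> backward steps the index \<open>i\<close> has just been
  handled, so \<open>pos (n - i)\<close> is the position at time \<open>d i\<close>.\<close>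

definition meet_pos :: "nat \<Rightarrow> real" where
  "meet_pos i = (if early i then pos (n - i) else 0)"

text \<open>Windows after the end of the tour count as well: a server that rests at 0 stays in the
  cone of every client it has met.\<close>

definition path :: "(real \<Rightarrow> real) \<Rightarrow> bool" where
  "path y \<longleftrightarrow> y 0 = 0 \<and> (\<forall>u w. \<bar>y u - y w\<bar> \<le> \<bar>u - w\<bar>) \<and>
     (\<forall>i<n. bounded i \<longrightarrow> wl i \<le> y (d i) \<and> y (d i) \<le> wh i)"

section \<open>What the forward scan implies about arbitrary paths\<close>

lemma prev_le: "i \<le> j \<Longrightarrow> j < n \<Longrightarrow> prev i \<le> d j"
proof (induction i)
  case 0
  then show ?case using nonneg by simp
next
  case (Suc i)
  then show ?case using sorted[of i j] by simp
qed

text \<open>The server leaves 0 at time 0. The backward scan uses this bound to see that its stops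
  can be reached from the start.\<close>

lemma lo_hi_prev: "- prev i \<le> lo i \<and> hi i \<le> prev i"
  by (induction i) auto

text \<open>Between deadlines the bounds relax by the elapsed time, and windows only tighten them.
  Hence a point of a later interval is within reach of all earlier ones.\<close>

lemma lo_hi_step:
  "j < i \<Longrightarrow> i \<le> n \<Longrightarrow> bounded j \<Longrightarrow>
    lo (Suc j) - (prev i - d j) \<le> lo i \<and> hi i \<le> hi (Suc j) + (prev i - d j)"
proof (induction i)
  case (Suc i)
  show ?case
  proof (cases "j = i")
    case False
    then have "lo (Suc j) - (prev i - d j) \<le> lo i \<and> hi i \<le> hi (Suc j) + (prev i - d j)"
      using Suc by simp
    then show ?thesis
      unfolding prev.simps(2)[of i] lo.simps(2)[of i] hi.simps(2)[of i]
      by (auto simp del: lo.simps hi.simps)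
  qed (use Suc in simp)
qed simp

lemma path_lo_hi:
  assumes "path y" "i \<le> n"
  shows "lo i \<le> y (prev i) \<and> y (prev i) \<le> hi i"
  using assms(2)
proof (induction i)
  case 0
  then show ?case using assms(1) by (simp add: path_def)
next
  case (Suc i)
  then have "\<bar>y (d i) - y (prev i)\<bar> \<le> d i - prev i"
    using assms(1) prev_le[of i i] unfolding path_def by (metis Suc_le_lessD abs_of_nonneg diff_ge_0_iff_ge order_refl)
  then show ?case
    using Suc assms(1) by (auto simp: path_def)
qed

lemma path_nonempty:
  assumes "path y" "i < n" "bounded i"
  shows "lo (Suc i) \<le> y (d i)" "y (d i) \<le> hi (Suc i)"
  using path_lo_hi[OF assms(1), of "Suc i"] assms(2,3) by (simp_all del: lo.simps hi.simps)

lemma finish_mono: "i \<le> j \<Longrightarrow> finish i \<le> finish j"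
  by (rule lift_Suc_mono_le[of finish]) (simp_all add: max_def)

lemma finish_ge_R: "R \<le> finish i"
  using finish_mono[of 0 i] by simp

text \<open>A path at rest in 0 from time \<open>t\<close> on has time \<open>t - d i\<close> to
  come home from the interval at \<open>d i\<close>, so \<open>t - d i\<close> is at least the
  distance of that interval from 0.\<close>

lemma finish_le:
  assumes y: "path y" "\<And>u. t \<le> u \<Longrightarrow> y u = 0" and t: "R \<le> t" and "i \<le> n"
  shows "finish i \<le> t"
  using \<open>i \<le> n\<close>
proof (induction i)
  case (Suc i)
  show ?case
  proof (cases "bounded i \<and> d i < R")
    case True
    have "\<bar>y (d i) - y t\<bar> \<le> t - d i"
      using y(1) True t unfolding path_def by (metis abs_minus_commute abs_of_nonneg diff_ge_0_iff_ge less_imp_le order_trans)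
    then show ?thesis
      using True Suc path_nonempty[OF y(1), of i] y(2)[of t]
      by (simp add: abs_le_iff del: lo.simps hi.simps)
  qed (use Suc in auto)
qed (use t in simp)

text \<open>
  \<open>finish\<close> takes only the deadlines before \<open>R\<close> into account: all later windows contain the position 0.
\<close>
lemma reach_home:
  assumes home: "\<And>i. i < n \<Longrightarrow> bounded i \<Longrightarrow> R \<le> d i \<Longrightarrow> wl i \<le> 0 \<and> 0 \<le> wh i"
    and "i \<le> n" "prev i \<le> finish n"
  shows "lo i \<le> finish n - prev i \<and> - hi i \<le> finish n - prev i"
  using assms(2,3)
proof (induction i)
  case (Suc i)
  show ?case
  proof (cases "bounded i")
    case True
    then have IH: "lo i \<le> finish n - prev i \<and> - hi i \<le> finish n - prev i"
      using Suc prev_le[of i i] by simp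
    show ?thesis
    proof (cases "d i < R")
      case less: True
      then show ?thesis
        using finish_mono[of "Suc i" n] Suc True by (simp del: lo.simps hi.simps)
    next
      \<comment> \<open>The window contains 0, so its own ends satisfy the bound; a relaxed end does
        so because the bound shrinks by the same elapsed time.\<close>
      case False
      then show ?thesis
        using home[of i] IH Suc True by auto
    qed
  qed (use Suc in simp)
qed simp

section \<open>Construction of a path by the backward scan\<close>

lemma early_window:
  assumes "i < n" "early i" "lo (Suc i) \<le> hi (Suc i)"
  shows "wl i \<le> meet_pos i" "meet_pos i \<le> wh i"
proof -
  have "n - i = Suc (n - Suc i)"
    using assms(1) by simp
  moreover have "n - (n - Suc i) = Suc i" "n - Suc (n - Suc i) = i"
    using assms(1) by auto
  ultimately have "meet_pos i = max (min (pos (n - Suc i)) (hi (Suc i))) (lo (Suc i))"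
    using assms(2) by (simp add: meet_pos_def del: lo.simps hi.simps)
  moreover have "wl i \<le> lo (Suc i)" "hi (Suc i) \<le> wh i"
    using assms(2) by (auto simp: early_def)
  ultimately show "wl i \<le> meet_pos i" "meet_pos i \<le> wh i"
    using assms(3) by (auto simp del: lo.simps hi.simps)
qed

text \<open>The invariant says that the current position can be joined to both ends of the tour,
  that it is within reach of all early intervals still to come, and that the meetings already fixed
  obey the Lipschitz bounds. The middle part makes the next clamp a move of speed at most 1.\<close>

lemma backward:
  assumes home: "\<And>i. i < n \<Longrightarrow> bounded i \<Longrightarrow> R \<le> d i \<Longrightarrow> wl i \<le> 0 \<and> 0 \<le> wh i"
    and nonempty: "\<And>i. i < n \<Longrightarrow> bounded i \<Longrightarrow> lo (Suc i) \<le> hi (Suc i)"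
    and R: "0 \<le> R" and "k \<le> n"
  shows "\<bar>pos k\<bar> \<le> finish n - time k \<and> \<bar>pos k\<bar> \<le> time k \<and>
    (\<forall>j<n - k. early j \<longrightarrow> d j \<le> time k \<and>
      lo (Suc j) - (time k - d j) \<le> pos k \<and> pos k \<le> hi (Suc j) + (time k - d j)) \<and>
    (\<forall>j\<in>{n - k..<n}. \<bar>meet_pos j - pos k\<bar> \<le> meet_time j - time k \<and>
       \<bar>meet_pos j\<bar> \<le> finish n - meet_time j) \<and>
    (\<forall>i\<in>{n - k..<n}. \<forall>j\<in>{n - k..<n}.
       \<bar>meet_pos i - meet_pos j\<bar> \<le> \<bar>meet_time i - meet_time j\<bar>)"
  using \<open>k \<le> n\<close>
proof (induction k)
  case 0
  \<comment> \<open>The scan starts at home at time \<open>finish n\<close>;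
    \<open>reach_home\<close> puts all early intervals within reach.\<close>
  have "lo (Suc j) \<le> finish n - d j \<and> - hi (Suc j) \<le> finish n - d j" if "j < n" "early j" for j
    using reach_home[OF home, of "Suc j"] that by (simp add: early_def del: lo.simps hi.simps)
  then show ?case
    using finish_ge_R[of n] R by (force simp: early_def simp del: lo.simps hi.simps)
next
  case (Suc k)
  define i where "i = n - Suc k"
  have i: "i < n" "n - k = Suc i" "n - Suc k = i" "n - i = Suc k"
    using Suc.prems by (auto simp: i_def)
  have range: "{i..<n} = insert i {Suc i..<n}"
    using i by auto
  note IH = Suc.IH[OF Suc_leD[OF Suc.prems], unfolded i(2)]
  have IH1: "\<bar>pos k\<bar> \<le> finish n - time k" "\<bar>pos k\<bar> \<le> time k"
    using IH by auto
  have IH2: "d j \<le> time k" "lo (Suc j) - (time k - d j) \<le> pos k"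
      "pos k \<le> hi (Suc j) + (time k - d j)" if "j \<le> i" "early j" for j
    using IH that by (auto simp: less_Suc_eq_le simp del: lo.simps hi.simps)
  have IH3: "\<bar>meet_pos j - pos k\<bar> \<le> meet_time j - time k" "\<bar>meet_pos j\<bar> \<le> finish n - meet_time j"
    if "j \<in> {Suc i..<n}" for j
    using IH that by blast+
  have IH4: "\<bar>meet_pos j - meet_pos l\<bar> \<le> \<bar>meet_time j - meet_time l\<bar>"
    if "j \<in> {Suc i..<n}" "l \<in> {Suc i..<n}" for j l
    using IH that by blast
  show ?case
  proof (cases "early i")
    case True
    have p: "pos (Suc k) = max (min (pos k) (hi (Suc i))) (lo (Suc i))" "time (Suc k) = d i"
      using True i by (simp_all del: lo.simps hi.simps)
    have mi: "meet_pos i = pos (Suc k)" "meet_time i = d i"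
      using True i by (simp_all add: meet_pos_def meet_time_def del: pos.simps)
    have b: "bounded i"
      using True by (simp add: early_def)
    have ne: "lo (Suc i) \<le> hi (Suc i)"
      using nonempty i b by blast
    have in_window: "lo (Suc i) \<le> pos (Suc k)" "pos (Suc k) \<le> hi (Suc i)"
      using ne by (auto simp: p(1) simp del: lo.simps hi.simps pos.simps)
    \<comment> \<open>The clamped point is the nearest one of the interval, and the invariant for
      \<open>j = i\<close> bounds its distance.\<close>
    have move: "\<bar>pos (Suc k) - pos k\<bar> \<le> time k - d i"
      using IH2[of i] True ne by (auto simp: p(1) simp del: lo.simps hi.simps pos.simps)
    have c1: "\<bar>pos (Suc k)\<bar> \<le> finish n - d i"
      using move IH1 by linarith
    have c2: "\<bar>pos (Suc k)\<bar> \<le> d i"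
      using lo_hi_prev[of "Suc i"] in_window b by (simp add: abs_le_iff del: lo.simps hi.simps pos.simps)
    \<comment> \<open>Since \<open>prev (Suc i) = d i\<close>, \<open>lo_hi_step\<close> at
      \<open>Suc i\<close> relates the interval just entered to all earlier ones.\<close>
    have c3: "d j \<le> d i \<and> lo (Suc j) - (d i - d j) \<le> pos (Suc k) \<and>
        pos (Suc k) \<le> hi (Suc j) + (d i - d j)" if "j < i" "early j" for j
      using lo_hi_step[of j "Suc i"] sorted[of j i] that i b in_window
      by (auto simp: early_def simp del: lo.simps hi.simps pos.simps)
    have c4: "\<bar>meet_pos j - pos (Suc k)\<bar> \<le> meet_time j - d i" if "j \<in> {Suc i..<n}" for j
      using IH3(1)[OF that] move by linarith
    show ?thesis
      unfolding i(3) p(2) range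
      using c1 c2 c3 c4 IH3(2) IH4 mi
      by (fastforce simp del: lo.simps hi.simps pos.simps simp: abs_le_iff)
  next
    \<comment> \<open>A late client is met at 0 at the end; the bounds on the way home in the
      invariant compare it with the current position and the fixed meetings.\<close>
    case False
    have p: "pos (Suc k) = pos k" "time (Suc k) = time k"
      using False i by simp_all
    have mi: "meet_pos i = 0" "meet_time i = finish n"
      using False i by (simp_all add: meet_pos_def meet_time_def)
    show ?thesis
      unfolding i(3) p range
      using IH1 IH2 IH3 IH4 mi
      by (fastforce simp del: lo.simps hi.simps simp: abs_le_iff)
  qed
qed

text \<open>This is the invariant after \<open>n\<close> steps, when every index has been
  handled.\<close>

lemma meet_feasible:
  assumes home: "\<And>i. i < n \<Longrightarrow> bounded i \<Longrightarrow> R \<le> d i \<Longrightarrow> wl i \<le> 0 \<and> 0 \<le> wh i"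
    and nonempty: "\<And>i. i < n \<Longrightarrow> bounded i \<Longrightarrow> lo (Suc i) \<le> hi (Suc i)"
    and R: "0 \<le> R"
  shows "i < n \<Longrightarrow> j < n \<Longrightarrow> \<bar>meet_pos i - meet_pos j\<bar> \<le> \<bar>meet_time i - meet_time j\<bar>"
    and "i < n \<Longrightarrow> \<bar>meet_pos i\<bar> \<le> meet_time i"
    and "i < n \<Longrightarrow> \<bar>meet_pos i\<bar> \<le> finish n - meet_time i"
proof -
  note B = backward[of n, OF home nonempty R order_refl, simplified]
  show "i < n \<Longrightarrow> j < n \<Longrightarrow> \<bar>meet_pos i - meet_pos j\<bar> \<le> \<bar>meet_time i - meet_time j\<bar>"
    "i < n \<Longrightarrow> \<bar>meet_pos i\<bar> \<le> finish n - meet_time i"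
    using B by simp_all
  \<comment> \<open>The last backward position \<open>pos n\<close> links the meeting to the start
    at 0.\<close>
  show "\<bar>meet_pos i\<bar> \<le> meet_time i" if "i < n"
  proof -
    have "\<bar>pos n\<bar> \<le> time n" "\<bar>meet_pos i - pos n\<bar> \<le> meet_time i - time n"
      using B that by simp_all
    then show ?thesis by linarith
  qed
qed

end

section \<open>The windows of the clients of an instance\<close>

locale sorted_clients = deadline_windows n bounded d wl wh R
  for n :: nat and bounded :: "nat \<Rightarrow> bool" and d wl wh :: "nat \<Rightarrow> real" and R :: real +
  fixes I :: "'a cltsp" and client :: "nat \<Rightarrow> 'a"
  assumes inst: "cltsp_instance I" and proc: "\<forall>a\<in>clients I. proc I a = 0"
    and fast: "1 \<le> speed I"
    and bij: "bij_betw client {..<n} (clients I)"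
    and bounded_iff: "i < n \<Longrightarrow> bounded i \<longleftrightarrow> deadline I (client i) \<noteq> \<infinity>"
    and d_eq: "i < n \<Longrightarrow> d i = real_of_ereal (deadline I (client i))"
    and wl_eq: "i < n \<Longrightarrow> wl i = start I (client i) - speed I * (d i - release I (client i))"
    and wh_eq: "i < n \<Longrightarrow> wh i = start I (client i) + speed I * (d i - release I (client i))"
    and R_nonneg: "0 \<le> R"
    and R_upper: "a \<in> clients I \<Longrightarrow> release I a + \<bar>start I a\<bar> / speed I \<le> R"
    and R_least: "0 \<le> t \<Longrightarrow> (\<And>a. a \<in> clients I \<Longrightarrow> release I a + \<bar>start I a\<bar> / speed I \<le> t) \<Longrightarrow> R \<le> t"
begin

lemma client_in: "i < n \<Longrightarrow> client i \<in> clients I"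
  using bij by (auto simp: bij_betw_def)

lemma clientE:
  assumes "a \<in> clients I"
  obtains i where "i < n" "a = client i"
  using assms bij by (auto simp: bij_betw_def)

text \<open>\<open>real_of_ereal\<close> sends both infinities to 0; nonnegative deadlines exclude
  \<open>-\<infinity>\<close>.\<close>

lemma deadline_eq: "i < n \<Longrightarrow> bounded i \<Longrightarrow> deadline I (client i) = ereal (d i)"
  using inst client_in[of i]
  by (cases "deadline I (client i)") (auto simp: d_eq bounded_iff cltsp_instance_def)

text \<open>From the rendezvous on, the server stays in the cone of the client. At the deadlines
  this makes its trajectory a \<open>path\<close>; at the end, where it is at 0, it gives
  \<open>R \<le> end_time S\<close>.\<close>

lemma feasible_necessary:
  assumes S: "feasible I S"
  shows "\<And>i. i < n \<Longrightarrow> bounded i \<Longrightarrow> lo (Suc i) \<le> hi (Suc i)" and "finish n \<le> end_time S"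
proof -
  obtain y where y: "\<And>u w. \<bar>y u - y w\<bar> \<le> \<bar>u - w\<bar>" "y 0 = 0"
    "\<And>u. end_time S \<le> u \<Longrightarrow> y u = 0" "0 \<le> end_time S"
    "\<And>a. a \<in> clients I \<Longrightarrow> rdv_time S a \<le> end_time S \<and> y (rdv_time S a) = rdv_pos S a"
    using feasible_path[OF S proc] by blast
  have cone: "\<bar>y u - start I a\<bar> \<le> speed I * (u - release I a)"
    if "a \<in> clients I" "rdv_time S a \<le> u" for a u
  proof (rule cone_path[OF fast _ that(2)])
    show "release I a + \<bar>rdv_pos S a - start I a\<bar> / speed I \<le> rdv_time S a"
      using S that(1) by (simp add: feasible_def)
    show "\<bar>y u - rdv_pos S a\<bar> \<le> u - rdv_time S a"
      using y(1)[of u "rdv_time S a"] y(5)[OF that(1)] that(2) by simp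
  qed
  have "wl i \<le> y (d i) \<and> y (d i) \<le> wh i" if i: "i < n" "bounded i" for i
  proof -
    have "ereal (rdv_time S (client i)) \<le> deadline I (client i)"
      using S client_in[OF i(1)] by (simp add: feasible_def)
    then have "rdv_time S (client i) \<le> d i"
      using deadline_eq[OF i] by simp
    then show ?thesis
      using cone[OF client_in[OF i(1)]] i by (fastforce simp: wl_eq wh_eq abs_le_iff)
  qed
  then have path: "path y"
    using y(1,2) by (simp add: path_def)
  show "lo (Suc i) \<le> hi (Suc i)" if "i < n" "bounded i" for i
    using path_nonempty[OF path that] by linarith
  have "R \<le> end_time S"
  proof (rule R_least[OF y(4)])
    fix a assume "a \<in> clients I"
    then have "\<bar>0 - start I a\<bar> \<le> speed I * (end_time S - release I a)"
      using cone[of a "end_time S"] y(3)[of "end_time S"] y(5) by simp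
    then show "release I a + \<bar>start I a\<bar> / speed I \<le> end_time S"
      using fast by (simp add: field_simps)
  qed
  then show "finish n \<le> end_time S"
    using finish_le[OF path y(3)] by simp
qed

text \<open>Early meetings lie in their windows, and 0 lies in every cone from time \<open>R\<close>
  on, hence at \<open>finish n\<close>.\<close>

lemma feasible_sufficient:
  assumes nonempty: "\<And>i. i < n \<Longrightarrow> bounded i \<Longrightarrow> lo (Suc i) \<le> hi (Suc i)"
  obtains S where "feasible I S" "end_time S = finish n"
    "\<And>i. i < n \<Longrightarrow> rdv_time S (client i) = meet_time i \<and> rdv_pos S (client i) = meet_pos i"
proof -
  \<comment> \<open>Solutions map clients while the scans work with indices, so the enumeration is
    inverted.\<close>
  define idx where "idx = inv_into {..<n} client"
  have idx: "idx (client i) = i" if "i < n" for i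
    using bij that by (simp add: idx_def bij_betw_def inv_into_f_f)
  define S where "S = \<lparr>rdv_time = \<lambda>a. meet_time (idx a), rdv_pos = \<lambda>a. meet_pos (idx a),
    end_time = finish n, end_pos = 0\<rparr>"
  have home: "wl i \<le> 0 \<and> 0 \<le> wh i" if "i < n" "bounded i" "R \<le> d i" for i
  proof -
    have "release I (client i) + \<bar>start I (client i)\<bar> / speed I \<le> d i"
      using R_upper[OF client_in[OF that(1)]] that(3) by linarith
    then have "\<bar>start I (client i)\<bar> \<le> speed I * (d i - release I (client i))"
      using fast by (simp add: field_simps)
    then show ?thesis
      using that by (simp add: wl_eq wh_eq abs_le_iff)
  qed
  note meet = meet_feasible[OF home nonempty R_nonneg]
  have "feasible I S"
  proof (rule feasibleI[OF _ proc])
    show "finite (clients I)"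
      using inst by (simp add: cltsp_instance_def)
    show "end_pos S = 0" "0 \<le> end_time S"
      using finish_ge_R[of n] R_nonneg by (simp_all add: S_def)
    fix a assume a: "a \<in> clients I"
    then obtain i where i: "i < n" "a = client i"
      by (rule clientE)
    show "\<bar>rdv_pos S a - rdv_pos S b\<bar> \<le> \<bar>rdv_time S a - rdv_time S b\<bar>" if "b \<in> clients I" for b
    proof -
      from that obtain j where "j < n" "b = client j"
        by (rule clientE)
      then show ?thesis
        using meet(1) i idx by (simp add: S_def)
    qed
    show "\<bar>rdv_pos S a\<bar> \<le> rdv_time S a" "\<bar>rdv_pos S a\<bar> \<le> end_time S - rdv_time S a"
      using meet(2,3) i idx by (simp_all add: S_def)
    have cone: "release I a + \<bar>meet_pos i - start I a\<bar> / speed I \<le> meet_time i"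
    proof (cases "early i")
      case True
      then have "wl i \<le> meet_pos i \<and> meet_pos i \<le> wh i"
        using early_window[OF i(1)] nonempty[OF i(1)] by (simp add: early_def)
      then have "\<bar>meet_pos i - start I a\<bar> \<le> speed I * (d i - release I a)"
        using i by (simp add: wl_eq wh_eq abs_le_iff)
      then show ?thesis
        using True fast by (simp add: meet_time_def field_simps)
    next
      case False
      then show ?thesis
        using R_upper[OF a] finish_ge_R[of n] by (simp add: meet_time_def meet_pos_def)
    qed
    have "0 \<le> \<bar>meet_pos i - start I a\<bar> / speed I"
      using fast by simp
    then have "release I a \<le> meet_time i"
      using cone by linarith
    moreover have "0 \<le> release I a"
      using inst a by (simp add: cltsp_instance_def)
    \<comment> \<open>A client with a deadline that is not early has
      \<open>finish n \<le> d i\<close>.\<close>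
    moreover have "ereal (meet_time i) \<le> deadline I a"
      using deadline_eq[OF i(1)] bounded_iff[OF i(1)] i(2)
      by (cases "bounded i") (auto simp: meet_time_def early_def)
    ultimately show "0 \<le> rdv_time S a \<and>
        release I a + \<bar>rdv_pos S a - start I a\<bar> / speed I \<le> rdv_time S a \<and>
        release I a \<le> rdv_time S a \<and> ereal (rdv_time S a) \<le> deadline I a"
      using cone idx[OF i(1)] i(2) by (auto simp: S_def)
  qed
  then show thesis
    by (rule that) (simp_all add: S_def idx)
qed

end

section \<open>Reasoning about programs\<close>

fun loop_free :: "com \<Rightarrow> bool" where
  "loop_free (Seq c c') \<longleftrightarrow> loop_free c \<and> loop_free c'"
| "loop_free (Cond b c c') \<longleftrightarrow> loop_free c \<and> loop_free c'"
| "loop_free (While b c) \<longleftrightarrow> False"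
| "loop_free _ \<longleftrightarrow> True"

text \<open>Symbolic execution of loop-free programs by the simplifier; \<open>loop_free\<close>
  guards against the totalising clause for loops.\<close>

fun den :: "com \<Rightarrow> state \<Rightarrow> state" where
  "den (NAssign y e) s = s\<lparr>nvar := (nvar s)(y := nval e s)\<rparr>"
| "den (NStore y i e) s = s\<lparr>narr := (narr s)(y := (narr s y)(nval i s := nval e s))\<rparr>"
| "den (RAssign y e) s = s\<lparr>rvar := (rvar s)(y := rval e s)\<rparr>"
| "den (RStore y i e) s = s\<lparr>rarr := (rarr s)(y := (rarr s y)(nval i s := rval e s))\<rparr>"
| "den (Seq c c') s = den c' (den c s)"
| "den (Cond b c c') s = (if bval b s then den c s else den c' s)"
| "den _ s = s"

text \<open>Both branches of a conditional are charged: the sum bounds the maximum and simplifies to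
  a numeral.\<close>

fun max_cost :: "com \<Rightarrow> nat" where
  "max_cost (NAssign y e) = 1 + ncost e"
| "max_cost (NStore y i e) = 1 + ncost i + ncost e"
| "max_cost (RAssign y e) = 1 + rcost e"
| "max_cost (RStore y i e) = 1 + ncost i + rcost e"
| "max_cost (Seq c c') = max_cost c + max_cost c'"
| "max_cost (Cond b c c') = 1 + bcost b + (max_cost c + max_cost c')"
| "max_cost _ = 1"

lemma exec_den: "loop_free c \<Longrightarrow> \<exists>k\<le>max_cost c. exec c s k (den c s)"
proof (induction c arbitrary: s)
  case Skip
  then show ?case
    by (intro exI[of _ 1]) (simp add: exec.Skip[simplified])
next
  case (Seq c c')
  then obtain k k' where "k \<le> max_cost c" "exec c s k (den c s)"
    "k' \<le> max_cost c'" "exec c' (den c s) k' (den c' (den c s))"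
    by fastforce
  then show ?case
    by (intro exI[of _ "k + k'"]) (auto intro: exec.Seq)
next
  case (Cond b c c')
  show ?case
  proof (cases "bval b s")
    case True
    with Cond obtain k where "k \<le> max_cost c" "exec c s k (den c s)"
      by fastforce
    with True show ?thesis
      using exec.CondTrue[of b s c k "den c s" c']
      by (intro exI[of _ "1 + bcost b + k"]) simp
  next
    case False
    with Cond obtain k where "k \<le> max_cost c'" "exec c' s k (den c' s)"
      by fastforce
    with False show ?thesis
      using exec.CondFalse[of b s c' k "den c' s" c]
      by (intro exI[of _ "1 + bcost b + k"]) simp
  qed
qed (auto intro: exec.NAssign[simplified] exec.NStore[simplified] exec.RAssign[simplified] exec.RStore[simplified])

section \<open>Correctness statements with a time bound\<close>

definition runs :: "com \<Rightarrow> state \<Rightarrow> nat \<Rightarrow> (state \<Rightarrow> bool) \<Rightarrow> bool" where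
  "runs c s K Q \<longleftrightarrow> (\<exists>k\<le>K. \<exists>s'. exec c s k s' \<and> Q s')"

lemma runs_den: "loop_free c \<Longrightarrow> max_cost c \<le> K \<Longrightarrow> Q (den c s) \<Longrightarrow> runs c s K Q"
  unfolding runs_def using exec_den[of c s] le_trans by blast

lemma runs_mono: "runs c s K Q \<Longrightarrow> K \<le> K' \<Longrightarrow> (\<And>s'. Q s' \<Longrightarrow> Q' s') \<Longrightarrow> runs c s K' Q'"
  unfolding runs_def using le_trans by blast

lemma runs_Seq:
  assumes "runs c s K R" "\<And>s'. R s' \<Longrightarrow> runs c' s' K' Q"
  shows "runs (Seq c c') s (K + K') Q"
proof -
  from assms(1) obtain k s' where 1: "k \<le> K" "exec c s k s'" "R s'"
    unfolding runs_def by blast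
  with assms(2)[of s'] obtain k' s'' where 2: "k' \<le> K'" "exec c' s' k' s''" "Q s''"
    unfolding runs_def by blast
  from 1(1) 2(1) have "k + k' \<le> K + K'"
    by simp
  with exec.Seq[OF 1(2) 2(2)] 2(3) show ?thesis
    unfolding runs_def by blast
qed

lemma runs_Seq_den:
  assumes "loop_free c" "runs c' (den c s) K Q"
  shows "runs (Seq c c') s (max_cost c + K) Q"
proof (rule runs_Seq)
  show "runs c s (max_cost c) (\<lambda>s'. s' = den c s)"
    using assms(1) by (intro runs_den) simp_all
qed (use assms(2) in simp)

text \<open>The parameter \<open>m\<close> of the invariant bounds the number of iterations that are still to come.\<close>
lemma runs_While:
  assumes "Inv m s"
    and "\<And>m s. Inv m s \<Longrightarrow> bval b s \<Longrightarrow> \<exists>m'. m = Suc m' \<and> runs c s K (Inv m')"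
  shows "runs (While b c) s (Suc m * (1 + bcost b + K)) (\<lambda>s'. (\<exists>m'. Inv m' s') \<and> \<not> bval b s')"
  using assms(1)
proof (induction m arbitrary: s)
  case 0
  \<comment> \<open>A true guard would make 0 a successor.\<close>
  then have "\<not> bval b s"
    using assms(2) by blast
  then show ?case
    using 0 exec.WhileFalse[of b s c] unfolding runs_def
    by (rule_tac exI[of _ "1 + bcost b"]) auto
next
  case (Suc m)
  show ?case
  proof (cases "bval b s")
    case True
    then obtain k s' where 1: "k \<le> K" "exec c s k s'" "Inv m s'"
      using assms(2)[OF Suc.prems] unfolding runs_def by auto
    then obtain k' s'' where 2: "k' \<le> Suc m * (1 + bcost b + K)" "exec (While b c) s' k' s''"
        "\<exists>m'. Inv m' s''" "\<not> bval b s''"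
      using Suc.IH unfolding runs_def by blast
    have "exec (While b c) s (1 + bcost b + k + k') s''"
      using True 1(2) 2(2) by (rule exec.WhileTrue)
    moreover have "1 + bcost b + k + k' \<le> Suc (Suc m) * (1 + bcost b + K)"
      using 1(1) 2(1) by simp
    ultimately show ?thesis
      unfolding runs_def using 2(3,4) by blast
  next
    case False
    then show ?thesis
      using Suc.prems exec.WhileFalse[of b s c] unfolding runs_def
      by (rule_tac exI[of _ "1 + bcost b"]) auto
  qed
qed

definition For :: "vname \<Rightarrow> com \<Rightarrow> com" where
  "For y c = Seq (NAssign y (NConst 0)) (While (NLess (NVar y) (NVar ''n''))
     (Seq c (NAssign y (NAdd (NVar y) (NConst 1)))))"

text \<open>Every iteration pays 4 for the guard and 4 for the increment on top of the body; the
  factor \<open>n + 2\<close> also covers the final, failing guard and the initialisation.\<close>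

lemma runs_For:
  assumes c: "loop_free c" and y: "y \<noteq> ''n''"
    and init: "Inv 0 (s\<lparr>nvar := (nvar s)(y := 0)\<rparr>)" and n: "nvar s ''n'' = n"
    and step: "\<And>i s. Inv i s \<Longrightarrow> i < n \<Longrightarrow> nvar s ''n'' = n \<Longrightarrow> nvar s y = i \<Longrightarrow>
      nvar (den c s) ''n'' = n \<and> nvar (den c s) y = i \<and>
      Inv (Suc i) ((den c s)\<lparr>nvar := (nvar (den c s))(y := Suc i)\<rparr>)"
    and K: "max_cost c + 8 \<le> K"
  shows "runs (For y c) s (K * (n + 2)) (\<lambda>s'. Inv n s' \<and> nvar s' ''n'' = n)"
proof -
  define J where "J m s \<longleftrightarrow> (\<exists>i. i + m = n \<and> Inv i s \<and> nvar s ''n'' = n \<and> nvar s y = i)" for m s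
  let ?b = "NLess (NVar y) (NVar ''n'')" and ?c = "Seq c (NAssign y (NAdd (NVar y) (NConst 1)))"
  let ?s = "s\<lparr>nvar := (nvar s)(y := 0)\<rparr>"
  have "runs (While ?b ?c) ?s (Suc n * (1 + bcost ?b + (max_cost c + 4)))
      (\<lambda>s'. (\<exists>m'. J m' s') \<and> \<not> bval ?b s')"
  proof (rule runs_While)
    show "J n ?s"
      using init n y by (auto simp: J_def)
    show "\<exists>m'. m = Suc m' \<and> runs ?c s (max_cost c + 4) (J m')" if "J m s" "bval ?b s" for m s
    proof -
      from that obtain i where i: "i + m = n" "Inv i s" "nvar s ''n'' = n" "nvar s y = i"
        by (auto simp: J_def)
      with that(2) obtain m' where m': "m = Suc m'"
        by (cases m) auto
      have "runs ?c s (max_cost c + 4) (J m')"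
        using step[of i s] i m' y by (intro runs_den) (auto simp: c J_def)
      with m' show ?thesis
        by blast
    qed
  qed
  then have "runs (While ?b ?c) ?s (Suc n * (max_cost c + 8)) (\<lambda>s'. Inv n s' \<and> nvar s' ''n'' = n)"
    by (rule runs_mono) (auto simp: J_def)
  then have "runs (While ?b ?c) (den (NAssign y (NConst 0)) s) (Suc n * (max_cost c + 8))
      (\<lambda>s'. Inv n s' \<and> nvar s' ''n'' = n)"
    by simp
  then have "runs (For y c) s (max_cost (NAssign y (NConst 0)) + Suc n * (max_cost c + 8))
      (\<lambda>s'. Inv n s' \<and> nvar s' ''n'' = n)"
    unfolding For_def by (intro runs_Seq_den) simp_all
  moreover have "max_cost (NAssign y (NConst 0)) + Suc n * (max_cost c + 8) \<le> K * (n + 2)"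
    using mult_right_mono[OF K, of "n + 2"] by (simp add: algebra_simps)
  ultimately show ?thesis
    by (rule runs_mono) auto
qed

text \<open>Moving the conditional into the assigned value keeps one symbolic state instead of a
  case distinction.\<close>

lemma den_Cond_NAssign [simp]:
  "den (Cond b (NAssign y e) Skip) s =
    s\<lparr>nvar := (nvar s)(y := if bval b s then nval e s else nvar s y)\<rparr>"
  by simp

definition NMin :: "vname \<Rightarrow> nexp \<Rightarrow> com" where
  "NMin y e = Cond (NLess e (NVar y)) (NAssign y e) Skip"

definition RMax :: "vname \<Rightarrow> rexp \<Rightarrow> com" where
  "RMax y e = Cond (RLess (RVar y) e) (RAssign y e) Skip"

definition RMin :: "vname \<Rightarrow> rexp \<Rightarrow> com" where
  "RMin y e = Cond (RLess e (RVar y)) (RAssign y e) Skip"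

lemma den_min_max [simp]:
  "den (NMin y e) s = s\<lparr>nvar := (nvar s)(y := min (nvar s y) (nval e s))\<rparr>"
  "den (RMax y f) s = s\<lparr>rvar := (rvar s)(y := max (rvar s y) (rval f s))\<rparr>"
  "den (RMin y f) s = s\<lparr>rvar := (rvar s)(y := min (rvar s y) (rval f s))\<rparr>"
  by (auto simp: NMin_def RMax_def RMin_def min_def max_def)

lemma loop_free_min_max [simp]: "loop_free (NMin y e)" "loop_free (RMax y f)" "loop_free (RMin y f)"
  by (simp_all add: NMin_def RMax_def RMin_def)

lemma max_cost_min_max [simp]:
  "max_cost (NMin y e) = 5 + 2 * ncost e"
  "max_cost (RMax y f) = 5 + 2 * rcost f"
  "max_cost (RMin y f) = 5 + 2 * rcost f"
  by (simp_all add: NMin_def RMax_def RMin_def)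

section \<open>Bottom-up merge sort\<close>

text \<open>The blocks are aligned at multiples of \<open>w\<close>, the last one possibly cut off
  at \<open>n\<close>. Only the indices in \<open>p\<close> are permuted; the keys stay in
  place.\<close>

definition runs_sorted :: "nat \<Rightarrow> nat \<Rightarrow> (nat \<Rightarrow> real) \<Rightarrow> (nat \<Rightarrow> nat) \<Rightarrow> bool" where
  "runs_sorted w n key p \<longleftrightarrow>
     (\<forall>c u v. w * c \<le> u \<and> u \<le> v \<and> v < w * Suc c \<and> v < n \<longrightarrow> key (p u) \<le> key (p v))"

lemma runs_sortedD:
  "runs_sorted w n key p \<Longrightarrow> w dvd a \<Longrightarrow> a \<le> u \<Longrightarrow> u \<le> v \<Longrightarrow> v < a + w \<Longrightarrow> v < n \<Longrightarrow>
    key (p u) \<le> key (p v)"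
  unfolding runs_sorted_def by (elim dvdE) (metis add.commute mult_Suc_right)

text \<open>
  The run \<open>[a, h)\<close> of length at most \<open>2 * w\<close> is being merged from \<open>[i, m)\<close> and \<open>[j, h)\<close>;
  the first \<open>k\<close> entries of \<open>q\<close> have been written.
\<close>
inductive merging ::
  "nat \<Rightarrow> nat \<Rightarrow> (nat \<Rightarrow> real) \<Rightarrow> (nat \<Rightarrow> nat) \<Rightarrow> (nat \<Rightarrow> nat) \<Rightarrow> nat \<Rightarrow> nat \<Rightarrow> nat \<Rightarrow> nat \<Rightarrow> nat \<Rightarrow> bool"
  for n w key p q k i m j h where
  mergingI: "\<lbrakk>2 * w dvd a; a \<le> i; i \<le> m; m \<le> j; j \<le> h; h \<le> n; h \<le> a + 2 * w;
     h = n \<or> 2 * w dvd h; k + m = i + j; runs_sorted (2 * w) k key q;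
     mset (map q [0..<k]) = mset (map p [0..<i]) + mset (map p [m..<j]);
     \<And>u v. a \<le> u \<Longrightarrow> u \<le> v \<Longrightarrow> v < m \<Longrightarrow> key (p u) \<le> key (p v);
     \<And>u v. m \<le> u \<Longrightarrow> u \<le> v \<Longrightarrow> v < h \<Longrightarrow> key (p u) \<le> key (p v);
     \<And>u v. a \<le> u \<Longrightarrow> u < k \<Longrightarrow> (i \<le> v \<and> v < m) \<or> (j \<le> v \<and> v < h) \<Longrightarrow> key (q u) \<le> key (p v)\<rbrakk>
   \<Longrightarrow> merging n w key p q k i m j h"

lemma merging_init: "merging n w key p q 0 0 0 0 0"
  by (rule mergingI[of w 0]) (simp_all add: runs_sorted_def)

text \<open>When \<open>k\<close> reaches \<open>h\<close>, the equation
  \<open>k + m = i + j\<close> forces both runs to be exhausted. The next pair begins at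
  \<open>h\<close>, and the minima cut it off at \<open>n\<close>.\<close>

lemma merging_next_run:
  assumes M: "merging n w key p q k i m j h" and "\<not> k < h" "k < n"
    and p: "runs_sorted w n key p" and w: "0 < w"
  shows "merging n w key p q k h (min (h + w) n) (min (h + w) n) (min (min (h + w) n + w) n) \<and>
    k < min (min (h + w) n + w) n"
proof -
  from M obtain a where a: "i \<le> m" "m \<le> j" "j \<le> h" "h \<le> n" "h = n \<or> 2 * w dvd h" "k + m = i + j"
      "runs_sorted (2 * w) k key q"
      "mset (map q [0..<k]) = mset (map p [0..<i]) + mset (map p [m..<j])"
    by (rule merging.cases) (rule that; assumption)
  have eq: "k = h" "j = h" "i = m"
    using a(1-6) assms(2,3) by linarith+
  have h: "2 * w dvd h"
    using a(5) eq assms(3) by simp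
  then have wh: "w dvd h" "w dvd h + w"
    by (auto dest: dvd_mult_right)
  have "[0..<h] = [0..<m] @ [m..<h]"
    using a eq upt_add_eq_append[of 0 m "h - m"] by simp
  then have mset: "mset (map q [0..<k]) =
      mset (map p [0..<h]) + mset (map p [min (h + w) n..<min (h + w) n])"
    using a(8) eq by simp
  have left: "key (p u) \<le> key (p v)" if "h \<le> u" "u \<le> v" "v < min (h + w) n" for u v
    using runs_sortedD[OF p wh(1)] that by simp
  have right: "key (p u) \<le> key (p v)"
    if "min (h + w) n \<le> u" "u \<le> v" "v < min (min (h + w) n + w) n" for u v
    using runs_sortedD[OF p wh(2), of u v] that by (auto simp: min_def split: if_splits)
  have "min (min (h + w) n + w) n = n \<or> 2 * w dvd min (min (h + w) n + w) n"
  proof (cases "h + 2 * w \<le> n")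
    case True
    then have "min (min (h + w) n + w) n = h + 2 * w"
      by simp
    then show ?thesis
      using h by (simp only: dvd_add dvd_refl simp_thms)
  qed (auto simp: min_def)
  then have "merging n w key p q k h (min (h + w) n) (min (h + w) n) (min (min (h + w) n + w) n)"
    using a(3,4) eq
    by (intro mergingI[OF h _ _ _ _ _ _ _ _ a(7) mset left right]) auto
  then show ?thesis
    using eq assms(3) w by simp
qed

lemma runs_sorted_upd:
  assumes q: "runs_sorted w k key q" and a: "w dvd a" "a \<le> k" "k < a + w"
    and x: "\<And>u. a \<le> u \<Longrightarrow> u < k \<Longrightarrow> key (q u) \<le> key x"
  shows "runs_sorted w (Suc k) key (q(k := x))"
  unfolding runs_sorted_def
proof (intro allI impI, elim conjE)
  fix c u v assume uv: "w * c \<le> u" "u \<le> v" "v < w * Suc c" "v < Suc k"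
  show "key ((q(k := x)) u) \<le> key ((q(k := x)) v)"
  proof (cases "v = k")
    case True
    from a(1) obtain b where b: "a = w * b"
      by (auto simp: dvd_def)
    \<comment> \<open>The position \<open>k\<close> lies in block \<open>b\<close> and in block
      \<open>c\<close>, so these coincide.\<close>
    have "w * b < w * Suc c" "w * c < w * Suc b"
      using b a uv True by auto
    then have "c = b"
      by (simp only: mult_less_cancel1) linarith
    then show ?thesis
      using x[of u] uv b True by auto
  next
    case False
    then show ?thesis
      using q uv unfolding runs_sorted_def by auto
  qed
qed

lemma mset_map_upd: "mset (map (q(k := x)) [0..<Suc k]) = add_mset x (mset (map q [0..<k]))"
proof -
  have "map (q(k := x)) [0..<k] = map q [0..<k]"
    by simp
  then show ?thesis
    by simp
qed

text \<open>\<open>p i\<close> heads a sorted run and does not exceed the head of the other one, so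
  it is least among the entries left in both; the invariant places it above those written from
  \<open>a\<close> on.\<close>

lemma merging_left:
  assumes M: "merging n w key p q k i m j h"
    and c: "k < h" "i < m" "\<not> (j < h \<and> key (p j) < key (p i))"
  shows "merging n w key p (q(k := p i)) (Suc k) (Suc i) m j h"
proof (rule merging.cases[OF M])
  fix a
  assume a: "2 * w dvd a" "a \<le> i" "i \<le> m" "m \<le> j" "j \<le> h" "h \<le> n" "h \<le> a + 2 * w"
      "h = n \<or> 2 * w dvd h" "k + m = i + j" "runs_sorted (2 * w) k key q"
      "mset (map q [0..<k]) = mset (map p [0..<i]) + mset (map p [m..<j])"
    and b: "\<And>u v. a \<le> u \<Longrightarrow> u \<le> v \<Longrightarrow> v < m \<Longrightarrow> key (p u) \<le> key (p v)"
      "\<And>u v. m \<le> u \<Longrightarrow> u \<le> v \<Longrightarrow> v < h \<Longrightarrow> key (p u) \<le> key (p v)"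
      "\<And>u v. a \<le> u \<Longrightarrow> u < k \<Longrightarrow> (i \<le> v \<and> v < m) \<or> (j \<le> v \<and> v < h) \<Longrightarrow> key (q u) \<le> key (p v)"
  have sorted: "runs_sorted (2 * w) (Suc k) key (q(k := p i))"
    using a c b(3)[of _ i] by (intro runs_sorted_upd[of _ _ _ _ a]) auto
  have least: "key (p i) \<le> key (p v)" if "(Suc i \<le> v \<and> v < m) \<or> (j \<le> v \<and> v < h)" for v
    using that
  proof
    assume "Suc i \<le> v \<and> v < m"
    then show ?thesis using b(1)[of i v] a by simp
  next
    assume v: "j \<le> v \<and> v < h"
    then have "key (p i) \<le> key (p j)"
      using c(3) by auto
    then show ?thesis
      using b(2)[of j v] v a by simp
  qed
  have mset: "mset (map (q(k := p i)) [0..<Suc k]) = mset (map p [0..<Suc i]) + mset (map p [m..<j])"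
    unfolding mset_map_upd a(11) by simp
  show ?thesis
  proof (rule mergingI[OF a(1) _ _ _ _ a(6-8) _ sorted mset b(1,2)])
    show "key ((q(k := p i)) u) \<le> key (p v)"
      if "a \<le> u" "u < Suc k" "(Suc i \<le> v \<and> v < m) \<or> (j \<le> v \<and> v < h)" for u v
      using least[OF that(3)] b(3)[of u v] that by (auto simp: less_Suc_eq)
  qed (use a c  in simp_all)
qed

lemma merging_right:
  assumes M: "merging n w key p q k i m j h"
    and c: "k < h" "\<not> (i < m \<and> \<not> (j < h \<and> key (p j) < key (p i)))"
  shows "merging n w key p (q(k := p j)) (Suc k) i m (Suc j) h"
proof (rule merging.cases[OF M])
  fix a
  assume a: "2 * w dvd a" "a \<le> i" "i \<le> m" "m \<le> j" "j \<le> h" "h \<le> n" "h \<le> a + 2 * w"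
      "h = n \<or> 2 * w dvd h" "k + m = i + j" "runs_sorted (2 * w) k key q"
      "mset (map q [0..<k]) = mset (map p [0..<i]) + mset (map p [m..<j])"
    and b: "\<And>u v. a \<le> u \<Longrightarrow> u \<le> v \<Longrightarrow> v < m \<Longrightarrow> key (p u) \<le> key (p v)"
      "\<And>u v. m \<le> u \<Longrightarrow> u \<le> v \<Longrightarrow> v < h \<Longrightarrow> key (p u) \<le> key (p v)"
      "\<And>u v. a \<le> u \<Longrightarrow> u < k \<Longrightarrow> (i \<le> v \<and> v < m) \<or> (j \<le> v \<and> v < h) \<Longrightarrow> key (q u) \<le> key (p v)"
  \<comment> \<open>If the left run is exhausted, then \<open>i = m\<close> and the counting
    equation gives \<open>j = k\<close>; otherwise the comparison itself includes
    \<open>j < h\<close>.\<close>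
  have jh: "j < h"
    using a(3,9) c by linarith
  have sorted: "runs_sorted (2 * w) (Suc k) key (q(k := p j))"
    using a c jh b(3)[of _ j] by (intro runs_sorted_upd[of _ _ _ _ a]) auto
  have least: "key (p j) \<le> key (p v)" if "(i \<le> v \<and> v < m) \<or> (Suc j \<le> v \<and> v < h)" for v
    using that
  proof
    assume v: "i \<le> v \<and> v < m"
    then have "key (p j) \<le> key (p i)"
      using c(2) by auto
    then show ?thesis
      using b(1)[of i v] v a by simp
  next
    assume "Suc j \<le> v \<and> v < h"
    then show ?thesis using b(2)[of j v] a by simp
  qed
  have mset: "mset (map (q(k := p j)) [0..<Suc k]) = mset (map p [0..<i]) + mset (map p [m..<Suc j])"
    unfolding mset_map_upd a(11) using a(4) by simp
  show ?thesis
  proof (rule mergingI[OF a(1) _ _ _ _ a(6-8) _ sorted mset b(1,2)])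
    show "key ((q(k := p j)) u) \<le> key (p v)"
      if "a \<le> u" "u < Suc k" "(i \<le> v \<and> v < m) \<or> (Suc j \<le> v \<and> v < h)" for u v
      using least[OF that(3)] b(3)[of u v] that by (auto simp: less_Suc_eq)
  qed (use a c jh in simp_all)
qed

text \<open>With \<open>k = n\<close> the counting equation leaves no unread entry.\<close>

lemma merging_finish:
  assumes "merging n w key p q n i m j h"
  shows "runs_sorted (2 * w) n key q" "mset (map q [0..<n]) = mset (map p [0..<n])"
proof -
  from assms obtain a where a: "i \<le> m" "m \<le> j" "j \<le> h" "h \<le> n" "n + m = i + j"
      "runs_sorted (2 * w) n key q"
      "mset (map q [0..<n]) = mset (map p [0..<i]) + mset (map p [m..<j])"
    by (rule merging.cases) (rule that; assumption)
  then have "j = n" "i = m"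
    by linarith+
  moreover have "[0..<n] = [0..<m] @ [m..<n]"
    using a upt_add_eq_append[of 0 m "n - m"] by simp
  ultimately show "mset (map q [0..<n]) = mset (map p [0..<n])"
    using a(7) by simp
  show "runs_sorted (2 * w) n key q"
    by (fact a(6))
qed

section \<open>Merge sort as a while program\<close>

definition next_run :: com where
  "next_run =
    Cond (NLess (NVar ''k'') (NVar ''h'')) Skip
      (Seq (NAssign ''i'' (NVar ''h''))
      (Seq (NAssign ''m'' (NAdd (NVar ''h'') (NVar ''w'')))
      (Seq (NMin ''m'' (NVar ''n''))
      (Seq (NAssign ''j'' (NVar ''m''))
      (Seq (NAssign ''h'' (NAdd (NVar ''m'') (NVar ''w'')))
           (NMin ''h'' (NVar ''n'')))))))"

text \<open>The comparison reads the arrays even if a run is exhausted; arrays are total functions,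
  so this is harmless.\<close>

definition take_least :: com where
  "take_least =
    Cond
      (Conj (NLess (NVar ''i'') (NVar ''m''))
        (Neg (Conj (NLess (NVar ''j'') (NVar ''h''))
          (RLess (RArr ''d'' (NArr ''p'' (NVar ''j''))) (RArr ''d'' (NArr ''p'' (NVar ''i'')))))))
      (Seq (NStore ''q'' (NVar ''k'') (NArr ''p'' (NVar ''i'')))
           (NAssign ''i'' (NAdd (NVar ''i'') (NConst 1))))
      (Seq (NStore ''q'' (NVar ''k'') (NArr ''p'' (NVar ''j'')))
           (NAssign ''j'' (NAdd (NVar ''j'') (NConst 1))))"

text \<open>One step per written entry: a single loop over \<open>k\<close> merges all pairs of
  runs, so a pass is linear without an amortised analysis.\<close>

definition merge_step :: com where
  "merge_step = Seq next_run take_least"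

definition merge_pass :: com where
  "merge_pass =
    Seq (Seq (NAssign ''i'' (NConst 0)) (Seq (NAssign ''m'' (NConst 0))
        (Seq (NAssign ''j'' (NConst 0)) (NAssign ''h'' (NConst 0)))))
    (Seq (For ''k'' merge_step)
    (Seq (For ''k'' (NStore ''p'' (NVar ''k'') (NArr ''q'' (NVar ''k''))))
         (NAssign ''w'' (NAdd (NVar ''w'') (NVar ''w'')))))"

definition merge_sort :: com where
  "merge_sort = Seq (NAssign ''w'' (NConst 1)) (While (NLess (NVar ''w'') (NVar ''n'')) merge_pass)"

definition merge_frame :: "state \<Rightarrow> state \<Rightarrow> bool" where
  "merge_frame s s' \<longleftrightarrow> nvar s' ''n'' = nvar s ''n'' \<and> nvar s' ''w'' = nvar s ''w'' \<and>
     nvar s' ''k'' = nvar s ''k'' \<and> rvar s' = rvar s \<and> rarr s' = rarr s \<and>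
     narr s' ''inf'' = narr s ''inf'' \<and> narr s' ''p'' = narr s ''p''"

definition merging_state :: "nat \<Rightarrow> state \<Rightarrow> bool" where
  "merging_state k s \<longleftrightarrow>
     merging (nvar s ''n'') (nvar s ''w'') (rarr s ''d'') (narr s ''p'') (narr s ''q'') k
       (nvar s ''i'') (nvar s ''m'') (nvar s ''j'') (nvar s ''h'')"

lemma next_run_correct:
  assumes "merging_state k s" and s: "nvar s ''k'' = k" "k < nvar s ''n''" "0 < nvar s ''w''"
    and p: "runs_sorted (nvar s ''w'') (nvar s ''n'') (rarr s ''d'') (narr s ''p'')"
  shows "merge_frame s (den next_run s) \<and> merging_state k (den next_run s) \<and>
    k < nvar (den next_run s) ''h''"
proof (cases "k < nvar s ''h''")
  case True
  then show ?thesis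
    using assms by (simp add: next_run_def merge_frame_def)
next
  case False
  then show ?thesis
    using merging_next_run[OF assms(1)[unfolded merging_state_def] False s(2) p s(3)] s(1)
    by (simp add: next_run_def merge_frame_def merging_state_def)
qed

lemma take_least_correct:
  assumes "merging_state k s" and s: "nvar s ''k'' = k" "k < nvar s ''h''"
  shows "merge_frame s (den take_least s) \<and> merging_state (Suc k) (den take_least s)"
proof (cases "nvar s ''i'' < nvar s ''m'' \<and> \<not> (nvar s ''j'' < nvar s ''h'' \<and>
    rarr s ''d'' (narr s ''p'' (nvar s ''j'')) < rarr s ''d'' (narr s ''p'' (nvar s ''i'')))")
  case True
  then show ?thesis
    using merging_left[OF assms(1)[unfolded merging_state_def] s(2)] s(1)
    by (simp add: take_least_def merge_frame_def merging_state_def)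
next
  case False
  then show ?thesis
    using merging_right[OF assms(1)[unfolded merging_state_def] s(2) False] s(1)
    by (auto simp: take_least_def merge_frame_def merging_state_def)
qed

lemma merge_step_correct:
  assumes "merging_state k s" and s: "nvar s ''k'' = k" "k < nvar s ''n''" "0 < nvar s ''w''"
    and p: "runs_sorted (nvar s ''w'') (nvar s ''n'') (rarr s ''d'') (narr s ''p'')"
  shows "merge_frame s (den merge_step s) \<and> merging_state (Suc k) (den merge_step s)"
proof -
  have 1: "merge_frame s (den next_run s)" "merging_state k (den next_run s)"
      "k < nvar (den next_run s) ''h''"
    using next_run_correct[OF assms] by auto
  have "merge_frame (den next_run s) (den merge_step s) \<and> merging_state (Suc k) (den merge_step s)"
    unfolding merge_step_def den.simps
    by (rule take_least_correct) (use 1 s in \<open>simp_all add: merge_frame_def\<close>)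
  then show ?thesis
    using 1(1) by (simp add: merge_frame_def)
qed

lemma merge_pass_correct:
  assumes s: "nvar s ''n'' = n" "nvar s ''w'' = w" "0 < w"
    and p: "runs_sorted w n (rarr s ''d'') (narr s ''p'')"
  shows "runs merge_pass s (200 * (n + 2)) (\<lambda>s'. nvar s' ''n'' = n \<and> nvar s' ''w'' = 2 * w \<and>
      rvar s' = rvar s \<and> rarr s' = rarr s \<and> narr s' ''inf'' = narr s ''inf'' \<and>
      runs_sorted (2 * w) n (rarr s ''d'') (narr s' ''p'') \<and>
      mset (map (narr s' ''p'') [0..<n]) = mset (map (narr s ''p'') [0..<n]))"
proof -
  define frame where "frame s' \<longleftrightarrow> nvar s' ''n'' = n \<and> nvar s' ''w'' = w \<and> rvar s' = rvar s \<and>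
      rarr s' = rarr s \<and> narr s' ''inf'' = narr s ''inf''" for s' :: state
  define Inv1 where "Inv1 k s' \<longleftrightarrow> frame s' \<and> narr s' ''p'' = narr s ''p'' \<and> merging_state k s'"
    for k and s' :: state
  define Q where "Q q \<longleftrightarrow> runs_sorted (2 * w) n (rarr s ''d'') q \<and>
      mset (map q [0..<n]) = mset (map (narr s ''p'') [0..<n])" for q
  define Inv2 where "Inv2 k s' \<longleftrightarrow> frame s' \<and> Q (narr s' ''q'') \<and>
      (\<forall>i<k. narr s' ''p'' i = narr s' ''q'' i)" for k and s' :: state
  let ?init = "Seq (NAssign ''i'' (NConst 0)) (Seq (NAssign ''m'' (NConst 0))
        (Seq (NAssign ''j'' (NConst 0)) (NAssign ''h'' (NConst 0))))"
  let ?copy = "NStore ''p'' (NVar ''k'') (NArr ''q'' (NVar ''k''))"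
  let ?double = "NAssign ''w'' (NAdd (NVar ''w'') (NVar ''w''))"
  define Post where "Post s' \<longleftrightarrow> nvar s' ''n'' = n \<and> nvar s' ''w'' = 2 * w \<and>
      rvar s' = rvar s \<and> rarr s' = rarr s \<and> narr s' ''inf'' = narr s ''inf'' \<and> Q (narr s' ''p'')"
    for s' :: state
  have merge: "runs (For ''k'' merge_step) s1 (150 * (n + 2)) (\<lambda>s'. Inv1 n s' \<and> nvar s' ''n'' = n)"
    if s1: "Inv1 0 s1" for s1
  proof (rule runs_For)
    show "loop_free merge_step" "max_cost merge_step + 8 \<le> 150"
      by (simp_all add: merge_step_def next_run_def take_least_def)
    show "Inv1 0 (s1\<lparr>nvar := (nvar s1)(''k'' := 0)\<rparr>)" "nvar s1 ''n'' = n"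
      using s1 by (auto simp: Inv1_def frame_def merging_state_def)
    fix k s' assume *: "Inv1 k s'" "k < n" "nvar s' ''n'' = n" "nvar s' ''k'' = k"
    then have "merge_frame s' (den merge_step s') \<and> merging_state (Suc k) (den merge_step s')"
      using p s by (intro merge_step_correct) (simp_all add: Inv1_def frame_def)
    then show "nvar (den merge_step s') ''n'' = n \<and> nvar (den merge_step s') ''k'' = k \<and>
        Inv1 (Suc k) (den merge_step s'\<lparr>nvar := (nvar (den merge_step s'))(''k'' := Suc k)\<rparr>)"
      using * by (auto simp: Inv1_def frame_def merge_frame_def merging_state_def)
  qed simp
  have copy: "runs (For ''k'' ?copy) s2 (20 * (n + 2)) (\<lambda>s'. Inv2 n s' \<and> nvar s' ''n'' = n)"
    if s2: "Inv1 n s2" for s2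
  proof (rule runs_For)
    have "merging n w (rarr s ''d'') (narr s ''p'') (narr s2 ''q'') n
        (nvar s2 ''i'') (nvar s2 ''m'') (nvar s2 ''j'') (nvar s2 ''h'')"
      using s2 by (auto simp: Inv1_def frame_def merging_state_def)
    then have "Q (narr s2 ''q'')"
      unfolding Q_def by (intro conjI merging_finish)
    then show "Inv2 0 (s2\<lparr>nvar := (nvar s2)(''k'' := 0)\<rparr>)"
      using s2 by (simp add: Inv1_def Inv2_def frame_def)
    show "nvar s2 ''n'' = n"
      using s2 by (simp add: Inv1_def frame_def)
    fix k s' assume "Inv2 k s'" "nvar s' ''n'' = n" "nvar s' ''k'' = k"
    then show "nvar (den ?copy s') ''n'' = n \<and> nvar (den ?copy s') ''k'' = k \<and>
        Inv2 (Suc k) (den ?copy s'\<lparr>nvar := (nvar (den ?copy s'))(''k'' := Suc k)\<rparr>)"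
      by (simp add: Inv2_def frame_def less_Suc_eq)
  qed simp_all
  have double: "runs ?double s3 4 Post" if s3: "Inv2 n s3" for s3
  proof (rule runs_den)
    have "map (narr s3 ''p'') [0..<n] = map (narr s3 ''q'') [0..<n]"
      using s3 by (simp add: Inv2_def)
    moreover have "runs_sorted (2 * w) n (rarr s ''d'') (narr s3 ''p'')"
      using s3 by (auto simp: Inv2_def Q_def runs_sorted_def)
    ultimately have "Q (narr s3 ''p'')"
      using s3 by (simp only: Inv2_def Q_def)
    then show "Post (den ?double s3)"
      using s3 by (simp add: Inv2_def Post_def frame_def)
  qed simp_all
  have "runs ?init s 8 (Inv1 0)"
    by (rule runs_den) (simp_all add: Inv1_def frame_def merging_state_def merging_init s)
  then have "runs merge_pass s (8 + (150 * (n + 2) + (20 * (n + 2) + 4))) Post"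
    unfolding merge_pass_def using merge copy double by (blast intro: runs_Seq)
  then show ?thesis
    by (rule runs_mono) (simp_all add: Q_def Post_def)
qed

lemma runs_sorted_1: "runs_sorted (Suc 0) n key p"
proof -
  have "u = v" if "c \<le> u" "u \<le> v" "v < Suc c" for c u v :: nat
    using that by simp
  then show ?thesis
    unfolding runs_sorted_def by (metis mult_Suc mult_0 add_0_right order_refl)
qed

lemma merge_sort_correct:
  assumes s: "nvar s ''n'' = n" and m: "n \<le> 2 ^ m"
  shows "runs merge_sort s (2 + Suc m * (200 * (n + 3))) (\<lambda>s'. nvar s' ''n'' = n \<and>
      rvar s' = rvar s \<and> rarr s' = rarr s \<and> narr s' ''inf'' = narr s ''inf'' \<and>
      (\<forall>u v. u \<le> v \<and> v < n \<longrightarrow> rarr s ''d'' (narr s' ''p'' u) \<le> rarr s ''d'' (narr s' ''p'' v)) \<and>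
      mset (map (narr s' ''p'') [0..<n]) = mset (map (narr s ''p'') [0..<n]))"
proof -
  \<comment> \<open>The inequality with \<open>2 ^ m\<close> makes \<open>m\<close> a bound on the
    doublings to come: for \<open>m = 0\<close> it contradicts the guard.\<close>
  define Inv where "Inv m s' \<longleftrightarrow> nvar s' ''n'' = n \<and> 0 < nvar s' ''w'' \<and> n \<le> nvar s' ''w'' * 2 ^ m \<and>
      rvar s' = rvar s \<and> rarr s' = rarr s \<and> narr s' ''inf'' = narr s ''inf'' \<and>
      runs_sorted (nvar s' ''w'') n (rarr s ''d'') (narr s' ''p'') \<and>
      mset (map (narr s' ''p'') [0..<n]) = mset (map (narr s ''p'') [0..<n])" for m and s' :: state
  let ?b = "NLess (NVar ''w'') (NVar ''n'')"
  have start: "Inv m (den (NAssign ''w'' (NConst 1)) s)"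
    using s m runs_sorted_1 by (simp add: Inv_def)
  have "runs merge_sort s (max_cost (NAssign ''w'' (NConst 1)) +
      (Suc m * (1 + bcost ?b + 200 * (n + 2)))) (\<lambda>s'. (\<exists>m'. Inv m' s') \<and> \<not> bval ?b s')"
    unfolding merge_sort_def
  proof (rule runs_Seq_den[OF _ runs_While[of Inv, OF start]])
    fix m s' assume *: "Inv m s'" "bval ?b s'"
    then obtain m' where m': "m = Suc m'"
      by (cases m) (auto simp: Inv_def)
    have "runs merge_pass s' (200 * (n + 2)) (Inv m')"
    proof (rule runs_mono[OF merge_pass_correct order_refl])
      show "nvar s' ''n'' = n" "nvar s' ''w'' = nvar s' ''w''" "0 < nvar s' ''w''"
        "runs_sorted (nvar s' ''w'') n (rarr s' ''d'') (narr s' ''p'')"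
        using * by (simp_all add: Inv_def)
    qed (use * m' in \<open>auto simp: Inv_def simp del: mset_map\<close>)
    then show "\<exists>m'. m = Suc m' \<and> runs merge_pass s' (200 * (n + 2)) (Inv m')"
      using m' by blast
  qed simp
  then show ?thesis
  proof (rule runs_mono)
    \<comment> \<open>The outer guard costs 4 per round, absorbed by passing from
      \<open>n + 2\<close> to \<open>n + 3\<close>.\<close>
    show "max_cost (NAssign ''w'' (NConst 1)) + Suc m * (1 + bcost ?b + 200 * (n + 2))
        \<le> 2 + Suc m * (200 * (n + 3))"
      by (intro add_mono mult_le_mono2) simp_all
    fix s' assume *: "(\<exists>m'. Inv m' s') \<and> \<not> bval ?b s'"
    \<comment> \<open>The guard has failed, so the block starting at 0 covers all \<open>n\<close>
      entries.\<close>
    then have "rarr s ''d'' (narr s' ''p'' u) \<le> rarr s ''d'' (narr s' ''p'' v)" if "u \<le> v" "v < n" for u v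
      using runs_sortedD[of "nvar s' ''w''" n "rarr s ''d''" "narr s' ''p''" 0 u v] that
      by (auto simp: Inv_def)
    then show "nvar s' ''n'' = n \<and>
      rvar s' = rvar s \<and> rarr s' = rarr s \<and> narr s' ''inf'' = narr s ''inf'' \<and>
      (\<forall>u v. u \<le> v \<and> v < n \<longrightarrow> rarr s ''d'' (narr s' ''p'' u) \<le> rarr s ''d'' (narr s' ''p'' v)) \<and>
      mset (map (narr s' ''p'') [0..<n]) = mset (map (narr s ''p'') [0..<n])"
      using * by (auto simp: Inv_def)
  qed
qed

section \<open>The algorithm\<close>

text \<open>\<open>''a''\<close> becomes the absolute value of the starting position, as the maximum
  of it and its negative.\<close>

definition prepare_step :: com where
  "prepare_step =
    Seq (NStore ''p'' (NVar ''k'') (NVar ''k''))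
    (Seq (RAssign ''a'' (RArr ''s'' (NVar ''k'')))
    (Seq (RMax ''a'' (RSub (RConst 0) (RArr ''s'' (NVar ''k''))))
         (RMax ''R'' (RAdd (RArr ''r'' (NVar ''k'')) (RDiv (RVar ''a'') (RVar ''v''))))))"

text \<open>\<open>''g''\<close> is the time since the previous deadline and \<open>''e''\<close> is
  half the width of the window.\<close>

definition intersect_window :: com where
  "intersect_window =
    Seq (RAssign ''g'' (RSub (RArr ''d'' (NVar ''c'')) (RVar ''pd'')))
    (Seq (RAssign ''pd'' (RArr ''d'' (NVar ''c'')))
    (Seq (RAssign ''e'' (RMul (RVar ''v'') (RSub (RVar ''pd'') (RArr ''r'' (NVar ''c'')))))
    (Seq (RAssign ''lo'' (RSub (RVar ''lo'') (RVar ''g'')))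
    (Seq (RMax ''lo'' (RSub (RArr ''s'' (NVar ''c'')) (RVar ''e'')))
    (Seq (RAssign ''hi'' (RAdd (RVar ''hi'') (RVar ''g'')))
         (RMin ''hi'' (RAdd (RArr ''s'' (NVar ''c'')) (RVar ''e''))))))))"

text \<open>An empty interval only clears the flag; the scan goes on, so the variables keep
  following the recursions and the loop has no early exit.\<close>

definition update_finish :: com where
  "update_finish =
    Seq (Cond (RLess (RVar ''hi'') (RVar ''lo'')) (NAssign ''feasible'' (NConst 0)) Skip)
        (Cond (RLess (RVar ''pd'') (RVar ''R''))
          (Seq (RMax ''end'' (RAdd (RVar ''pd'') (RVar ''lo'')))
               (RMax ''end'' (RSub (RVar ''pd'') (RVar ''hi''))))
          Skip)"

text \<open>Cell \<open>k\<close> of the arrays stores the interval with index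
  \<open>Suc k\<close>.\<close>

definition forward_step :: com where
  "forward_step =
    Seq (NAssign ''c'' (NArr ''p'' (NVar ''k'')))
    (Seq (Cond (NLess (NConst 0) (NArr ''inf'' (NVar ''c''))) Skip (Seq intersect_window update_finish))
    (Seq (RStore ''lo'' (NVar ''k'') (RVar ''lo''))
         (RStore ''hi'' (NVar ''k'') (RVar ''hi''))))"

text \<open>\<open>''k''\<close> counts backward steps, so index \<open>n - Suc k\<close> is
  handled; the result goes to the cell \<open>''c''\<close> of that client in the input
  enumeration.\<close>

definition backward_step :: com where
  "backward_step =
    Seq (NAssign ''i'' (NSub (NVar ''n'') (NAdd (NVar ''k'') (NConst 1))))
    (Seq (NAssign ''c'' (NArr ''p'' (NVar ''i'')))
    (Cond (Conj (Neg (NLess (NConst 0) (NArr ''inf'' (NVar ''c''))))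
          (RLess (RArr ''d'' (NVar ''c'')) (RVar ''end'')))
      (Seq (RMin ''y'' (RArr ''hi'' (NVar ''i'')))
      (Seq (RMax ''y'' (RArr ''lo'' (NVar ''i'')))
      (Seq (RStore ''t'' (NVar ''c'') (RArr ''d'' (NVar ''c'')))
           (RStore ''x'' (NVar ''c'') (RVar ''y'')))))
      (Seq (RStore ''t'' (NVar ''c'') (RVar ''end''))
           (RStore ''x'' (NVar ''c'') (RConst 0)))))"

definition start_scan :: com where
  "start_scan =
    Seq (NAssign ''feasible'' (NConst 1))
    (Seq (RAssign ''end'' (RVar ''R''))
    (Seq (RAssign ''pd'' (RConst 0))
    (Seq (RAssign ''lo'' (RConst 0))
    (Seq (RAssign ''hi'' (RConst 0))
         (RAssign ''y'' (RConst 0))))))"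

definition scan :: com where
  "scan = Seq start_scan (Seq (For ''k'' forward_step) (For ''k'' backward_step))"

definition solver :: com where
  "solver = Seq (For ''k'' prepare_step) (Seq merge_sort scan)"

section \<open>Correctness of the two scans\<close>

context deadline_windows
begin

text \<open>Injectivity keeps the stores for different clients apart.\<close>

definition windows_loaded :: "state \<Rightarrow> bool" where
  "windows_loaded s \<longleftrightarrow> rvar s ''R'' = R \<and> inj_on (narr s ''p'') {..<n} \<and>
     (\<forall>i<n. bounded i = (narr s ''inf'' (narr s ''p'' i) = 0) \<and>
       d i = rarr s ''d'' (narr s ''p'' i) \<and>
       wl i = rarr s ''s'' (narr s ''p'' i) - rvar s ''v'' * (d i - rarr s ''r'' (narr s ''p'' i)) \<and>
       wh i = rarr s ''s'' (narr s ''p'' i) + rvar s ''v'' * (d i - rarr s ''r'' (narr s ''p'' i)))"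

definition nonempty_upto :: "nat \<Rightarrow> bool" where
  "nonempty_upto k \<longleftrightarrow> (\<forall>i<k. bounded i \<longrightarrow> lo (Suc i) \<le> hi (Suc i))"

lemma nonempty_upto_Suc:
  "nonempty_upto (Suc k) \<longleftrightarrow> nonempty_upto k \<and> (bounded k \<longrightarrow> lo (Suc k) \<le> hi (Suc k))"
  by (auto simp: nonempty_upto_def less_Suc_eq simp del: lo.simps hi.simps)

text \<open>\<open>''y''\<close> already holds 0, the position from which the backward scan will
  start.\<close>

definition forward_state :: "nat \<Rightarrow> state \<Rightarrow> bool" where
  "forward_state k s \<longleftrightarrow> windows_loaded s \<and> rvar s ''y'' = 0 \<and> rvar s ''pd'' = prev k \<and>
     rvar s ''lo'' = lo k \<and> rvar s ''hi'' = hi k \<and> rvar s ''end'' = finish k \<and>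
     nvar s ''feasible'' = (if nonempty_upto k then 1 else 0) \<and>
     (\<forall>i<k. rarr s ''lo'' i = lo (Suc i) \<and> rarr s ''hi'' i = hi (Suc i))"

definition scan_frame :: "state \<Rightarrow> state \<Rightarrow> bool" where
  "scan_frame s s' \<longleftrightarrow> nvar s' ''n'' = nvar s ''n'' \<and> nvar s' ''k'' = nvar s ''k'' \<and>
     nvar s' ''c'' = nvar s ''c'' \<and> narr s' = narr s \<and> rarr s' = rarr s \<and>
     rvar s' ''v'' = rvar s ''v'' \<and> rvar s' ''R'' = rvar s ''R'' \<and> rvar s' ''y'' = rvar s ''y''"

lemma intersect_window_correct:
  "scan_frame s (den intersect_window s) \<and>
    rvar (den intersect_window s) ''end'' = rvar s ''end'' \<and>
    nvar (den intersect_window s) ''feasible'' = nvar s ''feasible'' \<and>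
    rvar (den intersect_window s) ''pd'' = rarr s ''d'' (nvar s ''c'') \<and>
    rvar (den intersect_window s) ''lo'' =
      max (rvar s ''lo'' - (rarr s ''d'' (nvar s ''c'') - rvar s ''pd''))
        (rarr s ''s'' (nvar s ''c'') -
          rvar s ''v'' * (rarr s ''d'' (nvar s ''c'') - rarr s ''r'' (nvar s ''c''))) \<and>
    rvar (den intersect_window s) ''hi'' =
      min (rvar s ''hi'' + (rarr s ''d'' (nvar s ''c'') - rvar s ''pd''))
        (rarr s ''s'' (nvar s ''c'') +
          rvar s ''v'' * (rarr s ''d'' (nvar s ''c'') - rarr s ''r'' (nvar s ''c'')))"
  by (simp add: intersect_window_def scan_frame_def)

lemma update_finish_correct:
  "scan_frame s (den update_finish s) \<and>
    rvar (den update_finish s) ''pd'' = rvar s ''pd'' \<and>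
    rvar (den update_finish s) ''lo'' = rvar s ''lo'' \<and>
    rvar (den update_finish s) ''hi'' = rvar s ''hi'' \<and>
    rvar (den update_finish s) ''end'' =
      (if rvar s ''pd'' < rvar s ''R''
       then max (max (rvar s ''end'') (rvar s ''pd'' + rvar s ''lo'')) (rvar s ''pd'' - rvar s ''hi'')
       else rvar s ''end'') \<and>
    nvar (den update_finish s) ''feasible'' =
      (if rvar s ''hi'' < rvar s ''lo'' then 0 else nvar s ''feasible'')"
  by (cases "rvar s ''pd'' < rvar s ''R''") (simp_all add: update_finish_def scan_frame_def)

lemma windows_loaded_frame: "scan_frame s s' \<Longrightarrow> windows_loaded s' = windows_loaded s"
  by (simp add: windows_loaded_def scan_frame_def)

lemma forward_window_correct:
  assumes s: "forward_state k s" "nvar s ''c'' = narr s ''p'' k" "k < n" "bounded k"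
    and s': "s' = den update_finish (den intersect_window s)"
  shows "scan_frame s s'"
    and "rvar s' ''pd'' = prev (Suc k)" and "rvar s' ''lo'' = lo (Suc k)"
    and "rvar s' ''hi'' = hi (Suc k)" and "rvar s' ''end'' = finish (Suc k)"
    and "nvar s' ''feasible'' = (if nonempty_upto (Suc k) then 1 else 0)"
proof -
  define s1 where "s1 = den intersect_window s"
  have w: "windows_loaded s" and vals: "rvar s ''pd'' = prev k" "rvar s ''lo'' = lo k"
      "rvar s ''hi'' = hi k" "rvar s ''end'' = finish k"
      "nvar s ''feasible'' = (if nonempty_upto k then 1 else 0)"
    using s(1) unfolding forward_state_def by blast+
  have R: "rvar s ''R'' = R"
    using w by (simp add: windows_loaded_def)
  have in_k: "rarr s ''d'' (narr s ''p'' k) = d k"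
      "rarr s ''s'' (narr s ''p'' k) - rvar s ''v'' * (d k - rarr s ''r'' (narr s ''p'' k)) = wl k"
      "rarr s ''s'' (narr s ''p'' k) + rvar s ''v'' * (d k - rarr s ''r'' (narr s ''p'' k)) = wh k"
    using w s(3) by (simp_all add: windows_loaded_def)
  have 1: "scan_frame s s1" "rvar s1 ''end'' = finish k" "rvar s1 ''pd'' = d k"
      "rvar s1 ''lo'' = lo (Suc k)" "rvar s1 ''hi'' = hi (Suc k)"
      "nvar s1 ''feasible'' = (if nonempty_upto k then 1 else 0)"
    using intersect_window_correct[of s] s(2,4) vals in_k by (simp_all add: s1_def)
  have "rvar s1 ''R'' = R"
    using 1(1) R by (simp add: scan_frame_def)
  note 2 = update_finish_correct[of s1, folded s'[folded s1_def], unfolded 1 this]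
  show "rvar s' ''pd'' = prev (Suc k)" "rvar s' ''lo'' = lo (Suc k)" "rvar s' ''hi'' = hi (Suc k)"
    "rvar s' ''end'' = finish (Suc k)"
    using 2 s(4) by (simp_all del: lo.simps hi.simps)
  show "nvar s' ''feasible'' = (if nonempty_upto (Suc k) then 1 else 0)"
    using 2 s(4) by (simp add: nonempty_upto_Suc del: lo.simps hi.simps)
  show "scan_frame s s'"
    using 1(1) 2 by (simp add: scan_frame_def)
qed

lemma forward_step_correct:
  assumes s: "forward_state k s" "nvar s ''k'' = k" "k < n"
  shows "forward_state (Suc k) (den forward_step s) \<and>
    nvar (den forward_step s) ''n'' = nvar s ''n'' \<and> nvar (den forward_step s) ''k'' = k \<and>
    narr (den forward_step s) = narr s"
proof -
  define s1 where "s1 = s\<lparr>nvar := (nvar s)(''c'' := narr s ''p'' k)\<rparr>"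
  define s2 where "s2 = (if bounded k then den update_finish (den intersect_window s1) else s1)"
  have s1: "forward_state k s1" "nvar s1 ''k'' = k" "nvar s1 ''c'' = narr s1 ''p'' k" "narr s1 = narr s"
      "nvar s1 ''n'' = nvar s ''n''"
    using s by (simp_all add: s1_def forward_state_def windows_loaded_def)
  have "(narr s ''inf'' (narr s ''p'' k) = 0) = bounded k"
    using s(1,3) by (simp add: forward_state_def windows_loaded_def)
  then have "den (Cond (NLess (NConst 0) (NArr ''inf'' (NVar ''c''))) Skip
      (Seq intersect_window update_finish)) s1 = s2"
    by (auto simp: s1_def s2_def)
  moreover have "den (NAssign ''c'' (NArr ''p'' (NVar ''k''))) s = s1"
    by (simp add: s1_def s(2))
  ultimately have step: "den forward_step s = s2\<lparr>rarr := (rarr s2)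
      (''lo'' := (rarr s2 ''lo'')(nvar s2 ''k'' := rvar s2 ''lo''),
       ''hi'' := (rarr s2 ''hi'')(nvar s2 ''k'' := rvar s2 ''hi''))\<rparr>"
    unfolding forward_step_def den.simps(5) by simp
  have "scan_frame s1 s2 \<and> rvar s2 ''pd'' = prev (Suc k) \<and> rvar s2 ''lo'' = lo (Suc k) \<and>
      rvar s2 ''hi'' = hi (Suc k) \<and> rvar s2 ''end'' = finish (Suc k) \<and>
      nvar s2 ''feasible'' = (if nonempty_upto (Suc k) then 1 else 0)"
  proof (cases "bounded k")
    case True
    then show ?thesis
      using forward_window_correct[OF s1(1,3) s(3) True refl] unfolding s2_def by simp
  next
    case False
    then show ?thesis
      using s1(1) by (simp add: s2_def forward_state_def scan_frame_def nonempty_upto_Suc)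
  qed
  then have s2: "scan_frame s1 s2" "rvar s2 ''pd'' = prev (Suc k)" "rvar s2 ''lo'' = lo (Suc k)"
      "rvar s2 ''hi'' = hi (Suc k)" "rvar s2 ''end'' = finish (Suc k)"
      "nvar s2 ''feasible'' = (if nonempty_upto (Suc k) then 1 else 0)"
    by blast+
  have old: "rarr s1 ''lo'' i = lo (Suc i) \<and> rarr s1 ''hi'' i = hi (Suc i)" if "i < k" for i
    using s1(1) that unfolding forward_state_def by blast
  have w: "windows_loaded s2" "rvar s2 ''y'' = 0"
    using s1(1) s2(1) by (simp_all add: forward_state_def windows_loaded_frame) (simp add: scan_frame_def)
  then have "windows_loaded (den forward_step s)"
    by (simp add: step windows_loaded_def)
  moreover have "nvar s2 ''k'' = k" "nvar s2 ''n'' = nvar s ''n''" "narr s2 = narr s" "rarr s2 = rarr s1"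
    using s2(1) s1 by (simp_all add: scan_frame_def)
  ultimately show ?thesis
    using s2(2-) w(2) old by (simp add: step forward_state_def less_Suc_eq del: lo.simps hi.simps)
qed

definition backward_state :: "nat \<Rightarrow> state \<Rightarrow> bool" where
  "backward_state k s \<longleftrightarrow> windows_loaded s \<and> rvar s ''y'' = pos k \<and> rvar s ''end'' = finish n \<and>
     nvar s ''feasible'' = (if nonempty_upto n then 1 else 0) \<and>
     (\<forall>i<n. rarr s ''lo'' i = lo (Suc i) \<and> rarr s ''hi'' i = hi (Suc i)) \<and>
     (\<forall>i<n. n - k \<le> i \<longrightarrow> rarr s ''t'' (narr s ''p'' i) = meet_time i \<and>
       rarr s ''x'' (narr s ''p'' i) = meet_pos i)"

lemma backward_step_correct:
  assumes s: "backward_state k s" "nvar s ''k'' = k" "k < n" "nvar s ''n'' = n"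
  shows "backward_state (Suc k) (den backward_step s) \<and>
    nvar (den backward_step s) ''n'' = n \<and> nvar (den backward_step s) ''k'' = k \<and>
    narr (den backward_step s) = narr s"
proof -
  define i where "i = n - Suc k"
  have i: "i < n" "n - k = Suc i" "n - Suc k = i" "n - i = Suc k"
    using s(3) by (auto simp: i_def)
  have w: "windows_loaded s" and vals: "rvar s ''y'' = pos k" "rvar s ''end'' = finish n"
      "nvar s ''feasible'' = (if nonempty_upto n then 1 else 0)"
      "\<And>j. j < n \<Longrightarrow> rarr s ''lo'' j = lo (Suc j)" "\<And>j. j < n \<Longrightarrow> rarr s ''hi'' j = hi (Suc j)"
    and old: "\<And>j. j < n \<Longrightarrow> Suc i \<le> j \<Longrightarrow> rarr s ''t'' (narr s ''p'' j) = meet_time j"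
      "\<And>j. j < n \<Longrightarrow> Suc i \<le> j \<Longrightarrow> rarr s ''x'' (narr s ''p'' j) = meet_pos j"
    using s(1) i by (auto simp: backward_state_def simp del: lo.simps hi.simps)
  have inj: "narr s ''p'' j = narr s ''p'' i \<longleftrightarrow> j = i" if "j < n" for j
    using w i(1) that by (auto simp: windows_loaded_def inj_on_def)
  have in_i: "(narr s ''inf'' (narr s ''p'' i) = 0) = bounded i" "rarr s ''d'' (narr s ''p'' i) = d i"
    using w i(1) by (auto simp: windows_loaded_def)
  have split: "i \<le> j \<longleftrightarrow> j = i \<or> Suc i \<le> j" for j
    by auto
  have p: "pos (Suc k) = (if early i then max (min (pos k) (hi (Suc i))) (lo (Suc i)) else pos k)"
    using i by (simp del: lo.simps hi.simps)
  have meet: "meet_time i = (if early i then d i else finish n)"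
      "meet_pos i = (if early i then pos (Suc k) else 0)"
    using i by (simp_all add: meet_time_def meet_pos_def del: pos.simps)
  \<comment> \<open>In the late case \<open>pos (Suc k) = pos k\<close>, so the update of
    \<open>''y''\<close> is the identity and both cases have one form.\<close>
  have step: "den backward_step s = s\<lparr>nvar := (nvar s)(''i'' := i, ''c'' := narr s ''p'' i),
      rvar := (rvar s)(''y'' := pos (Suc k)),
      rarr := (rarr s)(''t'' := (rarr s ''t'')(narr s ''p'' i := meet_time i),
        ''x'' := (rarr s ''x'')(narr s ''p'' i := meet_pos i))\<rparr>"
  proof (cases "early i")
    case True
    then have "bounded i" "d i < finish n"
      by (simp_all add: early_def)
    then show ?thesis
      using True vals(1,2) vals(4,5)[OF i(1)] in_i s(2,4) i(3)
      by (simp add: backward_step_def p meet del: lo.simps hi.simps pos.simps)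
  next
    case False
    then have "\<not> (bounded i \<and> d i < finish n)"
      by (simp add: early_def)
    then show ?thesis
      using False vals(1,2) in_i s(2,4) i(3) fun_upd_triv[of "rvar s" "''y''"]
      by (auto simp add: backward_step_def p meet simp del: lo.simps hi.simps pos.simps)
  qed
  have "windows_loaded (den backward_step s)"
    using w by (simp add: step windows_loaded_def)
  then show ?thesis
    using vals(2-) s(2,4) old i(3)
    by (simp add: step backward_state_def inj split imp_disjL del: lo.simps hi.simps pos.simps)
qed

lemma scan_correct:
  assumes s: "windows_loaded s" "nvar s ''n'' = n"
  shows "runs scan s (13 + (300 * (n + 2) + 300 * (n + 2)))
    (\<lambda>s'. rvar s' ''end'' = finish n \<and> nvar s' ''feasible'' = (if nonempty_upto n then 1 else 0) \<and>
      (\<forall>i<n. rarr s' ''t'' (narr s ''p'' i) = meet_time i \<and>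
        rarr s' ''x'' (narr s ''p'' i) = meet_pos i))"
proof -
  define Inv1 where "Inv1 k s' \<longleftrightarrow> forward_state k s' \<and> narr s' = narr s" for k s'
  define Inv2 where "Inv2 k s' \<longleftrightarrow> backward_state k s' \<and> narr s' = narr s" for k s'
  \<comment> \<open>Neither invariant reads the loop counter, so its updates preserve both.\<close>
  have upd: "forward_state k (s\<lparr>nvar := (nvar s)(''k'' := m)\<rparr>) = forward_state k s"
      "backward_state k (s\<lparr>nvar := (nvar s)(''k'' := m)\<rparr>) = backward_state k s" for k m s
    by (simp_all add: forward_state_def backward_state_def windows_loaded_def
        del: lo.simps hi.simps)
  have 1: "runs start_scan s 13 (\<lambda>s'. Inv1 0 s' \<and> nvar s' ''n'' = n)"
    by (rule runs_den) (use s in \<open>simp_all add: start_scan_def Inv1_def forward_state_def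
          windows_loaded_def nonempty_upto_def\<close>)
  have 2: "runs (For ''k'' forward_step) s1 (300 * (n + 2)) (\<lambda>s'. Inv1 n s' \<and> nvar s' ''n'' = n)"
    if s1: "Inv1 0 s1 \<and> nvar s1 ''n'' = n" for s1
  proof (rule runs_For)
    show "loop_free forward_step" "max_cost forward_step + 8 \<le> 300"
      by (simp_all add: forward_step_def intersect_window_def update_finish_def)
    show "Inv1 0 (s1\<lparr>nvar := (nvar s1)(''k'' := 0)\<rparr>)" "nvar s1 ''n'' = n"
      using s1 by (simp_all add: Inv1_def upd)
    fix k s' assume "Inv1 k s'" "k < n" "nvar s' ''n'' = n" "nvar s' ''k'' = k"
    then show "nvar (den forward_step s') ''n'' = n \<and> nvar (den forward_step s') ''k'' = k \<and>
        Inv1 (Suc k) (den forward_step s'\<lparr>nvar := (nvar (den forward_step s'))(''k'' := Suc k)\<rparr>)"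
      using forward_step_correct[of k s'] by (simp add: Inv1_def upd)
  qed simp
  have 3: "runs (For ''k'' backward_step) s2 (300 * (n + 2)) (\<lambda>s'. Inv2 n s' \<and> nvar s' ''n'' = n)"
    if s2: "Inv1 n s2 \<and> nvar s2 ''n'' = n" for s2
  proof (rule runs_For)
    show "loop_free backward_step" "max_cost backward_step + 8 \<le> 300"
      by (simp_all add: backward_step_def)
    \<comment> \<open>The condition on the output arrays is vacuous before the first backward step,
      as \<open>n - 0 \<le> i\<close> contradicts \<open>i < n\<close>.\<close>
    show "Inv2 0 (s2\<lparr>nvar := (nvar s2)(''k'' := 0)\<rparr>)" "nvar s2 ''n'' = n"
      using s2 by (simp_all add: Inv1_def Inv2_def upd)
        (simp add: forward_state_def backward_state_def del: lo.simps hi.simps)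
    fix k s' assume "Inv2 k s'" "k < n" "nvar s' ''n'' = n" "nvar s' ''k'' = k"
    then show "nvar (den backward_step s') ''n'' = n \<and> nvar (den backward_step s') ''k'' = k \<and>
        Inv2 (Suc k) (den backward_step s'\<lparr>nvar := (nvar (den backward_step s'))(''k'' := Suc k)\<rparr>)"
      using backward_step_correct[of k s'] by (simp add: Inv2_def upd)
  qed simp
  have "runs scan s (13 + (300 * (n + 2) + 300 * (n + 2))) (\<lambda>s'. Inv2 n s' \<and> nvar s' ''n'' = n)"
    unfolding scan_def using 1 2 3 by (blast intro: runs_Seq)
  then show ?thesis
    by (rule runs_mono) (auto simp: Inv2_def backward_state_def simp del: lo.simps hi.simps)
qed

end

section \<open>Correctness of the whole solver\<close>

lemma prepare_correct:
  assumes s: "nvar s ''n'' = n" "rvar s ''R'' = 0"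
  shows "runs (For ''k'' prepare_step) s (100 * (n + 2)) (\<lambda>s'. nvar s' ''n'' = n \<and>
      rarr s' = rarr s \<and> narr s' ''inf'' = narr s ''inf'' \<and> rvar s' ''v'' = rvar s ''v'' \<and>
      map (narr s' ''p'') [0..<n] = [0..<n] \<and> 0 \<le> rvar s' ''R'' \<and>
      (\<forall>i<n. rarr s ''r'' i + \<bar>rarr s ''s'' i\<bar> / rvar s ''v'' \<le> rvar s' ''R'') \<and>
      (\<forall>u\<ge>0. (\<forall>i<n. rarr s ''r'' i + \<bar>rarr s ''s'' i\<bar> / rvar s ''v'' \<le> u) \<longrightarrow> rvar s' ''R'' \<le> u))"
proof -
  define f where "f i = rarr s ''r'' i + \<bar>rarr s ''s'' i\<bar> / rvar s ''v''" for i
  \<comment> \<open>\<open>''R''\<close> is tracked as the least nonnegative upper bound, a property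
    that passes through each maximum and also fits an empty client set.\<close>
  define Inv where "Inv k s' \<longleftrightarrow> rarr s' = rarr s \<and> narr s' ''inf'' = narr s ''inf'' \<and>
      rvar s' ''v'' = rvar s ''v'' \<and> (\<forall>i<k. narr s' ''p'' i = i) \<and> 0 \<le> rvar s' ''R'' \<and>
      (\<forall>i<k. f i \<le> rvar s' ''R'') \<and> (\<forall>u\<ge>0. (\<forall>i<k. f i \<le> u) \<longrightarrow> rvar s' ''R'' \<le> u)"
    for k and s' :: state
  have abs: "max u (- u) = \<bar>u\<bar>" for u :: real
    by auto
  have "runs (For ''k'' prepare_step) s (100 * (n + 2)) (\<lambda>s'. Inv n s' \<and> nvar s' ''n'' = n)"
  proof (rule runs_For)
    show "loop_free prepare_step" "max_cost prepare_step + 8 \<le> 100"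
      by (simp_all add: prepare_step_def)
    show "Inv 0 (s\<lparr>nvar := (nvar s)(''k'' := 0)\<rparr>)"
      using s by (simp add: Inv_def)
    fix k s' assume "Inv k s'" "nvar s' ''n'' = n" "nvar s' ''k'' = k"
    then show "nvar (den prepare_step s') ''n'' = n \<and> nvar (den prepare_step s') ''k'' = k \<and>
        Inv (Suc k) (den prepare_step s'\<lparr>nvar := (nvar (den prepare_step s'))(''k'' := Suc k)\<rparr>)"
      by (auto simp: prepare_step_def Inv_def less_Suc_eq abs f_def[symmetric] le_max_iff_disj)
  qed (use s in simp_all)
  then show ?thesis
    by (rule runs_mono) (auto simp: Inv_def f_def map_nth intro!: nth_equalityI)
qed

lemma permutation_of_mset_map:
  assumes "mset (map p [0..<n]) = mset [0..<n]"
  shows "bij_betw p {..<n} {..<n}"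
proof -
  have "distinct (map p [0..<n])"
    using mset_eq_imp_distinct_iff[OF assms] by simp
  moreover have "p ` {..<n} = {..<n}"
    using mset_eq_setD[OF assms] by (simp add: atLeast_upt lessThan_atLeast0)
  ultimately show ?thesis
    by (simp add: bij_betw_def distinct_map lessThan_atLeast0)
qed

lemma solver_correct:
  fixes I :: "'a cltsp"
  assumes inst: "cltsp_instance I" and proc: "\<forall>a\<in>clients I. proc I a = 0" and fast: "1 \<le> speed I"
    and as: "distinct as" "set as = clients I" and n: "length as = n" and m: "n \<le> 2 ^ m"
  shows "runs solver (input_state I as)
    (100 * (n + 2) + (2 + Suc m * (200 * (n + 3)) + (13 + (300 * (n + 2) + 300 * (n + 2)))))
    (correct_output I as)"
  unfolding solver_def
proof (rule runs_Seq[OF prepare_correct])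
  define s0 where "s0 = input_state I as"
  show "nvar (input_state I as) ''n'' = n" "rvar (input_state I as) ''R'' = 0"
    using n by (simp_all add: input_state_def)
  have inp: "rarr s0 ''s'' i = start I (as ! i)" "rarr s0 ''r'' i = release I (as ! i)"
      "rarr s0 ''d'' i = real_of_ereal (deadline I (as ! i))"
      "narr s0 ''inf'' i = (if deadline I (as ! i) = \<infinity> then 1 else 0)" if "i < n" for i
    using that n by (simp_all add: s0_def input_state_def client_array_def)
  have v: "rvar s0 ''v'' = speed I"
    by (simp add: s0_def input_state_def)
  fix s1 :: state assume "nvar s1 ''n'' = n \<and>
      rarr s1 = rarr (input_state I as) \<and> narr s1 ''inf'' = narr (input_state I as) ''inf'' \<and>
      rvar s1 ''v'' = rvar (input_state I as) ''v'' \<and>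
      map (narr s1 ''p'') [0..<n] = [0..<n] \<and> 0 \<le> rvar s1 ''R'' \<and>
      (\<forall>i<n. rarr (input_state I as) ''r'' i + \<bar>rarr (input_state I as) ''s'' i\<bar> /
         rvar (input_state I as) ''v'' \<le> rvar s1 ''R'') \<and>
      (\<forall>u\<ge>0. (\<forall>i<n. rarr (input_state I as) ''r'' i + \<bar>rarr (input_state I as) ''s'' i\<bar> /
         rvar (input_state I as) ''v'' \<le> u) \<longrightarrow> rvar s1 ''R'' \<le> u)"
  note s1 = this[folded s0_def]
  have s1_n: "nvar s1 ''n'' = n" and s1_p: "map (narr s1 ''p'') [0..<n] = [0..<n]"
    using s1 by blast+
  show "runs (Seq merge_sort scan) s1
      (2 + Suc m * (200 * (n + 3)) + (13 + (300 * (n + 2) + 300 * (n + 2)))) (correct_output I as)"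
  proof (rule runs_Seq[OF merge_sort_correct[OF s1_n m]])
    fix s :: state assume s: "nvar s ''n'' = n \<and> rvar s = rvar s1 \<and> rarr s = rarr s1 \<and>
        narr s ''inf'' = narr s1 ''inf'' \<and>
        (\<forall>u v. u \<le> v \<and> v < n \<longrightarrow> rarr s1 ''d'' (narr s ''p'' u) \<le> rarr s1 ''d'' (narr s ''p'' v)) \<and>
        mset (map (narr s ''p'') [0..<n]) = mset (map (narr s1 ''p'') [0..<n])"
    define p where "p = narr s ''p''"
    define R where "R = rvar s ''R''"
    \<comment> \<open>\<open>p\<close> lists the input indices by deadline, so
      \<open>client i\<close> is the client at place \<open>i\<close> of that order.\<close>
    define client where "client i = as ! p i" for i
    define bounded where "bounded i \<longleftrightarrow> deadline I (client i) \<noteq> \<infinity>" for i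
    define d where "d i = real_of_ereal (deadline I (client i))" for i
    define wl where "wl i = start I (client i) - speed I * (d i - release I (client i))" for i
    define wh where "wh i = start I (client i) + speed I * (d i - release I (client i))" for i
    have same: "rarr s = rarr s0" "narr s ''inf'' = narr s0 ''inf''" "rvar s ''v'' = speed I"
      using s s1 v by simp_all
    have "mset (map p [0..<n]) = mset [0..<n]"
      using s s1_p unfolding p_def by metis
    then have p: "bij_betw p {..<n} {..<n}"
      by (rule permutation_of_mset_map)
    then have p_less: "p i < n" if "i < n" for i
      using that by (auto simp: bij_betw_def)
    have nth: "bij_betw ((!) as) {..<n} (clients I)"
      using as n by (simp add: bij_betw_nth)
    have R: "0 \<le> R" "\<And>i. i < n \<Longrightarrow> release I (as ! i) + \<bar>start I (as ! i)\<bar> / speed I \<le> R"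
      "\<And>u. 0 \<le> u \<Longrightarrow> (\<And>i. i < n \<Longrightarrow> release I (as ! i) + \<bar>start I (as ! i)\<bar> / speed I \<le> u) \<Longrightarrow> R \<le> u"
      using s s1 inp v by (simp_all add: R_def)
    interpret sorted_clients n bounded d wl wh R I client
    proof
      show "d i \<le> d j" if "i \<le> j" "j < n" for i j
      proof -
        have "rarr s1 ''d'' (p i) \<le> rarr s1 ''d'' (p j)"
          using s that by (simp add: p_def)
        then show ?thesis
          using s1 inp(3) p_less that by (simp add: d_def client_def)
      qed
      show "0 \<le> d i" if "i < n" for i
        using inst as n p_less[OF that]
        by (auto simp: d_def client_def cltsp_instance_def intro!: real_of_ereal_pos)
      show "bij_betw client {..<n} (clients I)"
        using bij_betw_trans[OF p nth] by (simp add: client_def comp_def cong: bij_betw_cong)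
      have ex: "\<exists>i<n. a = as ! i" if "a \<in> clients I" for a
        using that as n by (metis in_set_conv_nth)
      show "release I a + \<bar>start I a\<bar> / speed I \<le> R" if "a \<in> clients I" for a
        using ex[OF that] R(2) by blast
      show "R \<le> t" if "0 \<le> t" "\<And>a. a \<in> clients I \<Longrightarrow> release I a + \<bar>start I a\<bar> / speed I \<le> t" for t
        using R(3)[OF that(1)] that(2) as n nth_mem by blast
    qed (use inst proc fast R(1) in \<open>simp_all add: bounded_def d_def wl_def wh_def\<close>)
    have loaded: "windows_loaded s"
      unfolding windows_loaded_def same p_def[symmetric] R_def[symmetric]
      using p p_less inp
      by (simp add: bij_betw_def bounded_def d_def wl_def wh_def client_def)
    have "nvar s ''n'' = n"
      using s by blast
    then show "runs scan s (13 + (300 * (n + 2) + 300 * (n + 2))) (correct_output I as)"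
    proof (rule runs_mono[OF scan_correct[OF loaded] order_refl])
      fix s' :: state assume s': "rvar s' ''end'' = finish n \<and>
          nvar s' ''feasible'' = (if nonempty_upto n then 1 else 0) \<and>
          (\<forall>i<n. rarr s' ''t'' (narr s ''p'' i) = meet_time i \<and>
            rarr s' ''x'' (narr s ''p'' i) = meet_pos i)"
      show "correct_output I as s'"
      proof (cases "nonempty_upto n")
        case True
        then obtain S where S: "feasible I S" "end_time S = finish n"
          "\<And>i. i < n \<Longrightarrow> rdv_time S (client i) = meet_time i \<and> rdv_pos S (client i) = meet_pos i"
          using feasible_sufficient unfolding nonempty_upto_def by blast
        \<comment> \<open>By \<open>feasible_necessary\<close> no feasible solution ends before
          \<open>finish n\<close>.\<close>
        have "optimal I S"
          using S(1,2) feasible_necessary(2) by (simp add: optimal_def makespan_def)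
        moreover have "rdv_time S (as ! j) = rarr s' ''t'' j \<and> rdv_pos S (as ! j) = rarr s' ''x'' j"
          if "j < length as" for j
        proof -
          \<comment> \<open>The output arrays follow the input order; surjectivity of
            \<open>p\<close> finds the sorted place of each cell.\<close>
          obtain i where "i < n" "j = p i"
            using p \<open>j < length as\<close> n unfolding bij_betw_def by (metis imageE lessThan_iff)
          then show ?thesis
            using S(3)[of i] s' by (simp add: client_def p_def)
        qed
        ultimately show ?thesis
          using s' S(2) True unfolding correct_output_def by auto
      next
        case False
        then have "infeasible I"
          using feasible_necessary(1) unfolding infeasible_def nonempty_upto_def by blast
        then show ?thesis
          using s' False by (simp add: correct_output_def)
      qed
    qed
  qed
qed

section \<open>The running time bound\<close>

lemma ceiling_log2:
  obtains m where "n \<le> 2 ^ m" "real m \<le> log 2 (real n) + 1"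
proof (cases "n = 0")
  \<comment> \<open>Here \<open>log 2 0 = 0\<close> by convention.\<close>
  case True
  then show thesis
    using that[of 0] by (simp add: log_def)
next
  case False
  define m where "m = nat \<lceil>log 2 (real n)\<rceil>"
  have log: "0 \<le> log 2 (real n)"
    using False by simp
  have "log 2 (real n) \<le> real m"
    by (simp add: m_def real_nat_ceiling_ge)
  then have "real n \<le> 2 powr real m"
    using False by (simp add: log_le_iff)
  then have "real n \<le> real (2 ^ m)"
    by (simp add: powr_realpow)
  then have "n \<le> 2 ^ m"
    by (simp only: of_nat_le_iff)
  moreover have "real m \<le> log 2 (real n) + 1"
    unfolding m_def using log by linarith
  ultimately show thesis
    by (rule that)
qed

theorem theorem3:
  "\<exists>P T. T \<in> O(\<lambda>n. real n * ln (real n)) \<and>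
     solves_in_time P
       (\<lambda>I :: 'a cltsp. (\<forall>a\<in>clients I. proc I a = 0) \<and> speed I \<ge> 1) T"
proof -
  \<comment> \<open>\<open>Suc m\<close> is at most \<open>log 2 n + 2\<close>, the bound on the
    rounds of merge sort; \<open>700 * (n + 3)\<close> absorbs the linear phases and the
    constants.\<close>
  define T where "T n = (log 2 (real n) + 2) * (200 * (real n + 3)) + 700 * (real n + 3)" for n
  have "T \<in> O(\<lambda>n. real n * ln (real n))"
    unfolding T_def by real_asymp
  moreover have "solves_in_time solver
      (\<lambda>I :: 'a cltsp. (\<forall>a\<in>clients I. proc I a = 0) \<and> speed I \<ge> 1) T"
    unfolding solves_in_time_def
  proof (intro allI impI, elim conjE)
    fix I :: "'a cltsp" and as
    assume I: "cltsp_instance I" "\<forall>a\<in>clients I. proc I a = 0" "1 \<le> speed I"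
      and as: "distinct as" "set as = clients I"
    define n where "n = length as"
    have card: "card (clients I) = n"
      using as distinct_card by (metis n_def)
    obtain m where m: "n \<le> 2 ^ m" "real m \<le> log 2 (real n) + 1"
      by (rule ceiling_log2)
    let ?K = "100 * (n + 2) + (2 + Suc m * (200 * (n + 3)) + (13 + (300 * (n + 2) + 300 * (n + 2))))"
    obtain k s where k: "k \<le> ?K" "exec solver (input_state I as) k s" "correct_output I as s"
      using solver_correct[OF I as n_def[symmetric] m(1)] unfolding runs_def by blast
    have "real k \<le> real ?K"
      using k(1) by (simp only: of_nat_le_iff)
    also have "\<dots> \<le> (real m + 1) * (200 * (real n + 3)) + 700 * (real n + 3)"
      by (simp add: algebra_simps)
    also have "\<dots> \<le> T n"
      unfolding T_def using m(2) by (intro add_right_mono mult_right_mono) auto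
    finally show "\<exists>k s. exec solver (input_state I as) k s \<and> real k \<le> T (card (clients I)) \<and>
        correct_output I as s"
      using k(2,3) card by blast
  qed
  ultimately show ?thesis
    by blast
qed

end
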